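(* Let $A\subset[0,1]$ be a compact set with Hausdorff dimension $\dim A=\alpha<1/2$, and let $b$ be a (standard one-dimensional) Brownian motion on $[0,1]$. Then, almost surely, $\dim b(A)=2\alpha$.
   Context: $\dim$ denotes Hausdorff dimension, and $b(A)=\{b(t):t\in A\}$ is the image of $A$ under the Brownian path. *)

theory Defs
  imports "HOL-Probability.Probability"
begin

section \<open>Hausdorff measure and Hausdorff dimension\<close>

text \<open>
  The \<open>s\<close>-th power of the diameter of \<open>U\<close>, with the conventions that the empty set contributes
  \<open>0\<close> and that \<open>0\<^sup>0 = 1\<close> (whereas \<open>0 powr 0 = 0\<close>), so that for \<open>s = 0\<close> one obtains
  the counting measure.
\<close>

definition diameter_power :: "real \<Rightarrow> 'a::metric_space set \<Rightarrow> ennreal" where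
  "diameter_power s U =
     (if U = {} then 0 else if s = 0 then 1 else ennreal (diameter U powr s))"

text \<open>
  Boundedness is required explicitly because \<^const>\<open>diameter\<close> is real-valued and carries no
  information about unbounded sets. Finite covers are included by padding with empty sets.
\<close>

definition delta_covers :: "real \<Rightarrow> 'a::metric_space set \<Rightarrow> (nat \<Rightarrow> 'a set) set" where
  "delta_covers \<delta> A =
     {U. A \<subseteq> (\<Union>i. U i) \<and> (\<forall>i. bounded (U i) \<and> diameter (U i) \<le> \<delta>)}"

definition hausdorff_premeasure :: "real \<Rightarrow> real \<Rightarrow> 'a::metric_space set \<Rightarrow> ennreal" where
  "hausdorff_premeasure \<delta> s A = (INF U\<in>delta_covers \<delta> A. \<Sum>i. diameter_power s (U i))"

definition hausdorff_measure :: "real \<Rightarrow> 'a::metric_space set \<Rightarrow> ennreal" where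
  "hausdorff_measure s A = (SUP \<delta>\<in>{0<..}. hausdorff_premeasure \<delta> s A)"

text \<open>The infimum over the empty set is \<open>\<infinity>\<close>; the empty set has dimension \<open>0\<close>.\<close>

definition hausdorff_dim :: "'a::metric_space set \<Rightarrow> ennreal" where
  "hausdorff_dim A = (INF s\<in>{s. 0 \<le> s \<and> hausdorff_measure s A = 0}. ennreal s)"


section \<open>Standard one-dimensional Brownian motion on the unit interval\<close>

text \<open>
  The starting point and the continuity of paths are only required almost surely. The values of
  \<open>b t\<close> for \<open>t\<close> outside the unit interval are irrelevant. Note that the second parameter of
  \<^const>\<open>normal_density\<close> is the standard deviation, not the variance.
\<close>

locale brownian_motion = prob_space M for M :: "'w measure" +
  fixes b :: "real \<Rightarrow> 'w \<Rightarrow> real"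
  assumes measurable_b: "\<And>t. t \<in> {0..1} \<Longrightarrow> random_variable borel (b t)"
    and start_zero: "AE \<omega> in M. b 0 \<omega> = 0"
    and indep_increments:
      "\<And>(n::nat) t. (\<And>i. i \<le> n \<Longrightarrow> t i \<in> {0..1}) \<Longrightarrow> (\<And>i. i < n \<Longrightarrow> t i \<le> t (Suc i)) \<Longrightarrow>
        indep_vars (\<lambda>_. borel) (\<lambda>i \<omega>. b (t (Suc i)) \<omega> - b (t i) \<omega>) {..<n}"
    and normal_increments:
      "\<And>r u. 0 \<le> r \<Longrightarrow> r < u \<Longrightarrow> u \<le> 1 \<Longrightarrow>
        distributed M lborel (\<lambda>\<omega>. b u \<omega> - b r \<omega>) (normal_density 0 (sqrt (u - r)))"
    and continuous_paths: "AE \<omega> in M. continuous_on {0..1} (\<lambda>t. b t \<omega>)"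

end

theory Submission
  imports Defs
begin

text \<open>
  Upper bound: almost surely the path is locally Hoelder continuous with every exponent
  \<open>\<gamma> < 1 / 2\<close>, and such a map increases the dimension by a factor of at most \<open>1 / \<gamma>\<close>.

  Lower bound: let \<open>\<tau> < 2 * s < 2 * \<alpha>\<close>. Since \<open>A\<close> has positive \<open>s\<close>-dimensional Hausdorff content,
  the max-flow min-cut theorem on the dyadic tree of depth \<open>N\<close> yields a finitely supported measure
  on \<open>A\<close>, of mass bounded below, that gives mass at most a constant times \<open>r powr s\<close> to every
  interval of length \<open>r \<ge> 2 powr - N\<close>. As \<open>b x - b y\<close> is normal with variance \<open>\<bar>x - y\<bar>\<close> and
  \<open>\<tau> < 1\<close>, the expected \<open>\<tau>\<close>-energy of the image of this measure, truncated at the corresponding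
  spatial scale, is bounded uniformly in \<open>N\<close>. By Fatou's lemma, almost surely the energies stay
  bounded along a subsequence, and by the Cauchy-Schwarz inequality this bounds the sum
  \<open>\<Sum> r\<^sub>i powr \<tau>\<close> from below for every cover of \<open>b(A)\<close>.
\<close>

section \<open>Hausdorff measure\<close>

lemma diameter_power_pos: "s > 0 \<Longrightarrow> diameter_power s U = ennreal (diameter U powr s)"
  by (auto simp: diameter_power_def)

lemma diameter_power_antimono:
  assumes "0 \<le> s" "s \<le> t" "bounded U" "diameter U \<le> 1"
  shows "diameter_power t U \<le> diameter_power s U"
proof (cases "s = 0")
  case True
  have "diameter U powr t \<le> 1" using assms diameter_ge_0[of U] by (intro powr_le1) auto
  then show ?thesis using True by (auto simp: diameter_power_def)
next
  case False
  have "diameter U powr t \<le> diameter U powr s"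
    using assms diameter_ge_0[of U] by (cases "diameter U = 0") (auto intro: powr_mono')
  then show ?thesis using False assms by (auto simp: diameter_power_def intro: ennreal_leI)
qed

text \<open>A supremum in \<open>ennreal\<close> vanishes only if every member does, and an infimum
  vanishes exactly when some member lies below each \<epsilon> > 0. The dimension depends only on
  which exponents give measure \<open>0\<close>, so this \<epsilon>-form replaces any computation of
  measures.\<close>

lemma hausdorff_measure_eq_0_iff:
  "hausdorff_measure s A = 0 \<longleftrightarrow>
    (\<forall>\<delta>>0. \<forall>\<epsilon>>0. \<exists>U\<in>delta_covers \<delta> A. (\<Sum>i. diameter_power s (U i)) < ennreal \<epsilon>)"
proof -
  have eq0: "x = 0 \<longleftrightarrow> (\<forall>\<epsilon>>0. x < ennreal \<epsilon>)" for x :: ennreal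
  proof
    assume x: "\<forall>\<epsilon>>0. x < ennreal \<epsilon>"
    have "x \<le> 0 + ennreal \<epsilon>" if "\<epsilon> > 0" for \<epsilon>
      using x that by (auto intro: less_imp_le)
    then have "x \<le> 0" by (rule ennreal_le_epsilon) auto
    then show "x = 0" by simp
  qed auto
  have "hausdorff_measure s A = 0 \<longleftrightarrow> (\<forall>\<delta>\<in>{0<..}. hausdorff_premeasure \<delta> s A = 0)"
    unfolding hausdorff_measure_def le_zero_eq[symmetric] SUP_le_iff ..
  also have "\<dots> \<longleftrightarrow> (\<forall>\<delta>>0. \<forall>\<epsilon>>0. hausdorff_premeasure \<delta> s A < ennreal \<epsilon>)"
    unfolding eq0 by auto
  finally show ?thesis unfolding hausdorff_premeasure_def INF_less_iff .
qed

text \<open>The covers are taken with diameters at most \<open>1\<close> as well, because only then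
  does raising the exponent decrease every term.\<close>

lemma hausdorff_measure_eq_0_mono:
  assumes "0 \<le> s" "s \<le> t" "hausdorff_measure s A = 0"
  shows "hausdorff_measure t A = 0"
  unfolding hausdorff_measure_eq_0_iff
proof (intro allI impI)
  fix \<delta> \<epsilon> :: real assume "\<delta> > 0" "\<epsilon> > 0"
  then obtain U where U: "U \<in> delta_covers (min \<delta> 1) A" "(\<Sum>i. diameter_power s (U i)) < ennreal \<epsilon>"
    using assms(3)[unfolded hausdorff_measure_eq_0_iff, rule_format, of "min \<delta> 1" \<epsilon>] by auto
  have "(\<Sum>i. diameter_power t (U i)) \<le> (\<Sum>i. diameter_power s (U i))"
    using U(1) assms by (intro suminf_le diameter_power_antimono) (auto simp: delta_covers_def)
  with U show "\<exists>U\<in>delta_covers \<delta> A. (\<Sum>i. diameter_power t (U i)) < ennreal \<epsilon>"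
    by (intro bexI[of _ U]) (auto simp: delta_covers_def)
qed

lemma hausdorff_dim_le:
  "0 \<le> s \<Longrightarrow> hausdorff_measure s A = 0 \<Longrightarrow> hausdorff_dim A \<le> ennreal s"
  unfolding hausdorff_dim_def by (intro INF_lower) auto

lemma le_hausdorff_dim:
  assumes "0 \<le> s" "hausdorff_measure s A \<noteq> 0"
  shows "ennreal s \<le> hausdorff_dim A"
  unfolding hausdorff_dim_def
proof (intro INF_greatest)
  fix t assume t: "t \<in> {s. 0 \<le> s \<and> hausdorff_measure s A = 0}"
  then have "\<not> t \<le> s" using hausdorff_measure_eq_0_mono[of t s A] assms by auto
  then show "ennreal s \<le> ennreal t" by (auto intro: ennreal_leI)
qed

text \<open>Passes from covers by small sets to covers by bounded sets of any size: either all
  pieces have diameter at most \<delta>, and the premeasure at that scale bounds the sum, or one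
  larger piece already contributes \<open>\<delta> powr s\<close>.\<close>

lemma hausdorff_content_pos:
  assumes "s > 0" "hausdorff_measure s A \<noteq> 0"
  obtains c where "c > 0"
    "\<And>U. A \<subseteq> (\<Union>i::nat. U i) \<Longrightarrow> (\<And>i. bounded (U i)) \<Longrightarrow> ennreal c \<le> (\<Sum>i. diameter_power s (U i))"
proof -
  obtain \<delta> \<epsilon> where de: "\<delta> > 0" "\<epsilon> > 0"
    "\<And>U. U \<in> delta_covers \<delta> A \<Longrightarrow> ennreal \<epsilon> \<le> (\<Sum>i. diameter_power s (U i))"
    using assms(2) unfolding hausdorff_measure_eq_0_iff not_less by (auto simp: not_less)
  show thesis
  proof (rule that[of "min \<epsilon> (\<delta> powr s)"])
    fix U :: "nat \<Rightarrow> 'a set" assume U: "A \<subseteq> (\<Union>i. U i)" "\<And>i. bounded (U i)"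
    show "ennreal (min \<epsilon> (\<delta> powr s)) \<le> (\<Sum>i. diameter_power s (U i))"
    proof (cases "\<forall>i. diameter (U i) \<le> \<delta>")
      case True
      then have "ennreal \<epsilon> \<le> (\<Sum>i. diameter_power s (U i))"
        using U by (intro de) (auto simp: delta_covers_def)
      then show ?thesis by (meson ennreal_leI min.cobounded1 order_trans)
    next
      case False
      then obtain i where "diameter (U i) > \<delta>" by (auto simp: not_le)
      then have "\<delta> powr s \<le> diameter (U i) powr s" using de assms by (intro powr_mono2) auto
      then have "ennreal (min \<epsilon> (\<delta> powr s)) \<le> diameter_power s (U i)"
        using assms by (auto simp: diameter_power_pos intro!: ennreal_leI)
      also have "\<dots> \<le> (\<Sum>i. diameter_power s (U i))"
        using sum_le_suminf[of "\<lambda>i. diameter_power s (U i)" "{i}"] by auto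
      finally show ?thesis .
    qed
  qed (use de in auto)
qed

text \<open>Real-valued form for a finite cover with an arbitrary index type, padded to a sequence
  by empty sets. It is later applied to a cut of a tree, which is indexed by pairs.\<close>

lemma hausdorff_content_pos_finite:
  assumes "s > 0" "hausdorff_measure s A \<noteq> 0"
  obtains c where "c > 0"
    "\<And>(U :: 'i \<Rightarrow> _) C. finite C \<Longrightarrow> A \<subseteq> (\<Union>i\<in>C. U i) \<Longrightarrow> (\<And>i. i \<in> C \<Longrightarrow> bounded (U i)) \<Longrightarrow>
      c \<le> (\<Sum>i\<in>C. diameter (U i) powr s)"
proof -
  obtain c where c: "c > 0"
    "\<And>U. A \<subseteq> (\<Union>i::nat. U i) \<Longrightarrow> (\<And>i. bounded (U i)) \<Longrightarrow> ennreal c \<le> (\<Sum>i. diameter_power s (U i))"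
    by (rule hausdorff_content_pos[OF assms]) blast
  show thesis
  proof (rule that[OF c(1)])
    fix U :: "'i \<Rightarrow> 'a set" and C
    assume U: "finite C" "A \<subseteq> (\<Union>i\<in>C. U i)" "\<And>i. i \<in> C \<Longrightarrow> bounded (U i)"
    obtain h where h: "bij_betw h {..<card C} C"
      using ex_bij_betw_nat_finite[OF U(1)] by (auto simp: atLeast0LessThan)
    define V where "V i = (if i < card C then U (h i) else {})" for i
    have hC: "h ` {..<card C} = C" by (rule bij_betw_imp_surj_on[OF h])
    have "ennreal c \<le> (\<Sum>i. diameter_power s (V i))"
    proof (rule c(2))
      show "A \<subseteq> (\<Union>i. V i)"
      proof
        fix x assume "x \<in> A"
        with U(2) obtain k where k: "k \<in> C" "x \<in> U k" by blast
        from k(1) have "k \<in> h ` {..<card C}" unfolding hC .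
        then obtain i where "i < card C" "k = h i" by auto
        with k have "x \<in> V i" by (simp add: V_def)
        then show "x \<in> (\<Union>i. V i)" by blast
      qed
      show "bounded (V i)" for i using U(3)[of "h i"] bij_betwE[OF h] by (simp add: V_def)
    qed
    also have "(\<Sum>i. diameter_power s (V i)) = (\<Sum>i<card C. diameter_power s (V i))"
      by (intro suminf_finite) (auto simp: V_def diameter_power_def)
    also have "\<dots> = (\<Sum>i<card C. ennreal (diameter (U (h i)) powr s))"
      using assms by (intro sum.cong) (auto simp: V_def diameter_power_pos)
    also have "\<dots> = ennreal (\<Sum>i<card C. diameter (U (h i)) powr s)" by (intro sum_ennreal) auto
    also have "(\<Sum>i<card C. diameter (U (h i)) powr s) = (\<Sum>i\<in>C. diameter (U i) powr s)"
      by (rule sum.reindex_bij_betw[OF h])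
    finally show "c \<le> (\<Sum>i\<in>C. diameter (U i) powr s)"
      by (subst (asm) ennreal_le_iff) (auto intro: sum_nonneg)
  qed
qed

text \<open>A piece of diameter \<open>u\<close> has an image of diameter at most
  \<open>C * u powr \<gamma>\<close>, so with exponent \<open>s / \<gamma>\<close> the sum grows at
  most by the factor \<open>C powr (s / \<gamma>)\<close>. A Hoelder bound at distances up to
  \<open>d\<close> suffices since the cover may be chosen finer than \<open>d\<close>.\<close>

lemma hausdorff_measure_holder_image:
  fixes f :: "'a::metric_space \<Rightarrow> 'b::metric_space"
  assumes "\<gamma> > 0" "s \<ge> 0" "d > 0" "C > 0"
    and f: "\<And>x y. x \<in> A \<Longrightarrow> y \<in> A \<Longrightarrow> dist x y \<le> d \<Longrightarrow> dist (f x) (f y) \<le> C * dist x y powr \<gamma>"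
    and H: "hausdorff_measure s A = 0"
  shows "hausdorff_measure (s / \<gamma>) (f ` A) = 0"
proof (cases "s = 0")
  case True
  \<comment> \<open>For exponent \<open>0\<close> every nonempty piece counts \<open>1\<close>, so a
    sum below \<open>1\<close> forces all pieces, and hence \<open>A\<close>, to be empty.\<close>
  obtain U where U: "U \<in> delta_covers 1 A" "(\<Sum>i. diameter_power s (U i)) < ennreal 1"
    using H[unfolded hausdorff_measure_eq_0_iff, rule_format, of 1 1] by auto
  have "diameter_power s (U i) < ennreal 1" for i
    using sum_le_suminf[of "\<lambda>i. diameter_power s (U i)" "{i}"] U(2) by (auto intro: le_less_trans)
  then have "U i = {}" for i using True by (force simp: diameter_power_def split: if_splits)
  then have "A = {}" using U by (auto simp: delta_covers_def)
  then have "(\<lambda>_. {}) \<in> delta_covers \<delta> (f ` A)" if "\<delta> > 0" for \<delta>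
    using that by (auto simp: delta_covers_def)
  moreover have "(\<Sum>i::nat. diameter_power (s/\<gamma>) ({}::'b set)) = 0" by (simp add: diameter_power_def)
  ultimately show ?thesis
    unfolding hausdorff_measure_eq_0_iff by (intro allI impI bexI[of _ "\<lambda>_. {}"]) auto
next
  case False
  then have s: "s > 0" using assms by simp
  show ?thesis
    unfolding hausdorff_measure_eq_0_iff
  proof (intro allI impI)
    fix \<delta> \<epsilon> :: real assume de: "\<delta> > 0" "\<epsilon> > 0"
    \<comment> \<open>The first bound makes the Hoelder estimate applicable inside each piece, the
      second makes the image of a piece have diameter at most \<delta>.\<close>
    define \<eta> where "\<eta> = min d ((\<delta> / C) powr (1/\<gamma>))"
    define K where "K = C powr (s/\<gamma>)"
    have K: "K > 0" using assms by (auto simp: K_def)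
    have "\<eta> > 0" using assms de by (auto simp: \<eta>_def)
    then obtain U where U: "U \<in> delta_covers \<eta> A" "(\<Sum>i. diameter_power s (U i)) < ennreal (\<epsilon> / K)"
      using H[unfolded hausdorff_measure_eq_0_iff, rule_format, of \<eta> "\<epsilon> / K"] K de by auto
    define V where "V i = f ` (U i \<inter> A)" for i
    have Ub: "bounded (U i)" "diameter (U i) \<le> \<eta>" for i using U by (auto simp: delta_covers_def)
    have dist_V: "dist x y \<le> C * diameter (U i) powr \<gamma>" if xy: "x \<in> V i" "y \<in> V i" for x y i
    proof -
      obtain u v where uv: "u \<in> U i" "v \<in> U i" "u \<in> A" "v \<in> A" "x = f u" "y = f v"
        using xy by (auto simp: V_def)
      have d: "dist u v \<le> diameter (U i)" using Ub uv by (intro diameter_bounded_bound)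
      also have "\<dots> \<le> d" using Ub(2)[of i] by (auto simp: \<eta>_def)
      finally have "dist x y \<le> C * dist u v powr \<gamma>" using f uv by auto
      also have "\<dots> \<le> C * diameter (U i) powr \<gamma>"
        using d assms by (intro mult_left_mono powr_mono2) auto
      finally show ?thesis .
    qed
    have diamV: "diameter (V i) \<le> C * diameter (U i) powr \<gamma>" for i
    proof (cases "V i = {}")
      case True
      then show ?thesis using assms by simp
    next
      case False
      then show ?thesis
        unfolding diameter_def[of "V i"] using dist_V by (auto intro!: cSUP_least)
    qed
    have bV: "bounded (V i)" for i unfolding bounded_two_points using dist_V by blast
    have "diameter (V i) \<le> \<delta>" for i
    proof -
      have "diameter (V i) \<le> C * diameter (U i) powr \<gamma>" by (rule diamV)
      also have "\<dots> \<le> C * ((\<delta> / C) powr (1/\<gamma>)) powr \<gamma>"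
        using assms Ub[of i] diameter_ge_0[of "U i"]
        by (intro mult_left_mono powr_mono2) (auto simp: \<eta>_def)
      also have "\<dots> = \<delta>" using assms de by (simp add: powr_powr)
      finally show ?thesis .
    qed
    then have V: "V \<in> delta_covers \<delta> (f ` A)"
      using bV U unfolding delta_covers_def V_def by blast
    have "(\<Sum>i. diameter_power (s/\<gamma>) (V i)) \<le> (\<Sum>i. ennreal K * diameter_power s (U i))"
    proof (intro suminf_le)
      fix i
      have "diameter (V i) powr (s/\<gamma>) \<le> (C * diameter (U i) powr \<gamma>) powr (s/\<gamma>)"
        using diamV[of i] bV diameter_ge_0[of "V i"] s assms by (intro powr_mono2) auto
      also have "\<dots> = K * diameter (U i) powr s"
        using assms by (simp add: powr_mult powr_powr K_def)
      finally show "diameter_power (s/\<gamma>) (V i) \<le> ennreal K * diameter_power s (U i)"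
        using s assms K by (simp add: diameter_power_pos ennreal_mult[symmetric] ennreal_leI)
    qed auto
    also have "\<dots> = ennreal K * (\<Sum>i. diameter_power s (U i))" by simp
    also have "\<dots> < ennreal K * ennreal (\<epsilon> / K)"
      using U(2) K by (intro ennreal_mult_strict_left_mono) auto
    also have "\<dots> = ennreal \<epsilon>" using K de by (simp add: ennreal_mult[symmetric])
    finally show "\<exists>U\<in>delta_covers \<delta> (f ` A). (\<Sum>i. diameter_power (s/\<gamma>) (U i)) < ennreal \<epsilon>"
      using V by blast
  qed
qed

section \<open>Discrete energies\<close>

text \<open>A dyadic version of the Riesz kernel \<open>u powr - \<tau>\<close>, truncated at scale \<open>2 powr - n\<close>.\<close>

definition energy_kernel :: "real \<Rightarrow> nat \<Rightarrow> real \<Rightarrow> real" where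
  "energy_kernel \<tau> n u = (\<Sum>m\<le>n. if u \<le> 2 powr - real m then 2 powr (\<tau> * real m) else 0)"

lemma energy_kernel_nonneg: "0 \<le> energy_kernel \<tau> n u"
  unfolding energy_kernel_def by (intro sum_nonneg) auto

text \<open>A single summand is enough: \<open>m\<close> is the largest number with
  \<open>r \<le> 2 powr - real m\<close>, so that also \<open>2 powr - real m \<le> 2 * r\<close>,
  and its weight is at least \<open>(2 * r) powr - \<tau>\<close>. The hypothesis on
  \<open>n\<close> ensures that this scale survives the truncation.\<close>

lemma energy_kernel_ge:
  assumes "\<tau> > 0" "0 < r" "r \<le> 1" "2 powr - real n \<le> r" "u \<le> r"
  shows "1 \<le> (2 * r) powr \<tau> * energy_kernel \<tau> n u"
proof -
  define m where "m = nat \<lfloor>- log 2 r\<rfloor>"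
  have "- log 2 r \<ge> 0" using assms by (simp add: log_le_zero_cancel_iff)
  then have m: "real m \<le> - log 2 r" "- log 2 r < real m + 1" by (auto simp: m_def)
  have "log 2 (2 powr - real n) \<le> log 2 r"
    using assms by (subst log_le_cancel_iff) auto
  then have "m \<le> n" using m by simp
  have "r = 2 powr log 2 r" using assms by simp
  also have "\<dots> \<le> 2 powr - real m" using m by (intro powr_mono) auto
  finally have "u \<le> 2 powr - real m" using assms by linarith
  have "2 powr - real m = 2 * 2 powr (- real m - 1)" by (simp add: powr_diff)
  also have "\<dots> \<le> 2 * 2 powr log 2 r" using m by (intro mult_left_mono powr_mono) auto
  also have "\<dots> = 2 * r" using assms by simp
  finally have *: "2 powr - real m \<le> 2 * r" .
  have "1 = (2 powr - real m) powr \<tau> * 2 powr (\<tau> * real m)"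
    by (simp add: powr_powr powr_add[symmetric] mult.commute)
  also have "\<dots> \<le> (2 * r) powr \<tau> * 2 powr (\<tau> * real m)"
    using * assms by (intro mult_right_mono powr_mono2) auto
  also have "\<dots> \<le> (2 * r) powr \<tau> * energy_kernel \<tau> n u"
  proof (intro mult_left_mono)
    have "2 powr (\<tau> * real m) = (\<Sum>m\<in>{m}. if u \<le> 2 powr - real m then 2 powr (\<tau> * real m) else 0)"
      using \<open>u \<le> 2 powr - real m\<close> by simp
    also have "\<dots> \<le> energy_kernel \<tau> n u"
      unfolding energy_kernel_def using \<open>m \<le> n\<close> by (intro sum_mono2) auto
    finally show "2 powr (\<tau> * real m) \<le> energy_kernel \<tau> n u" .
  qed auto
  finally show ?thesis .
qed

text \<open>Two points of the ball \<open>i\<close> are at distance at most \<open>2 * r i\<close>,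
  so the squared mass of the points assigned to it is at most \<open>(4 * r i) powr \<tau>\<close>
  times their mutual energy. Cauchy-Schwarz sums this over the balls, and the energy between
  different balls is dropped because the kernel is nonnegative.\<close>

lemma energy_ball_cover:
  fixes y :: "'j \<Rightarrow> 'a::metric_space" and p :: "'i \<Rightarrow> 'a"
  assumes "\<tau> > 0" "finite J" "\<And>j. j \<in> J \<Longrightarrow> w j \<ge> 0" "finite I"
    and r: "\<And>i. i \<in> I \<Longrightarrow> 0 < r i \<and> 2 * r i \<le> 1 \<and> 2 powr - real n \<le> 2 * r i"
    and cover: "\<And>j. j \<in> J \<Longrightarrow> \<exists>i\<in>I. y j \<in> ball (p i) (r i)"
  shows "(\<Sum>j\<in>J. w j)\<^sup>2 \<le> 4 powr \<tau> * (\<Sum>i\<in>I. r i powr \<tau>) *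
     (\<Sum>i\<in>J. \<Sum>j\<in>J. w i * w j * energy_kernel \<tau> n (dist (y i) (y j)))"
proof -
  define K where "K i j = energy_kernel \<tau> n (dist (y i) (y j))" for i j
  \<comment> \<open>One ball is chosen for each point, so that the groups \<open>G i\<close>
    partition \<open>J\<close> even where balls overlap.\<close>
  obtain g where g: "\<And>j. j \<in> J \<Longrightarrow> g j \<in> I \<and> y j \<in> ball (p (g j)) (r (g j))"
    using bchoice[of J "\<lambda>j i. i \<in> I \<and> y j \<in> ball (p i) (r i)"] cover by blast
  define G where "G i = {j\<in>J. g j = i}" for i
  define W where "W i = (\<Sum>j\<in>G i. w j)" for i
  define E where "E i = (\<Sum>j\<in>G i. \<Sum>k\<in>G i. w j * w k * K j k)" for i
  have GJ: "finite (G i)" "G i \<subseteq> J" for i using assms by (auto simp: G_def)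
  have K0: "K i j \<ge> 0" for i j by (auto simp: K_def energy_kernel_nonneg)
  have wGJ: "w j \<ge> 0" if "j \<in> G i" for i j using that GJ assms by auto
  have E0: "E i \<ge> 0" for i unfolding E_def by (intro sum_nonneg mult_nonneg_nonneg wGJ K0)
  have W_le: "W i \<le> sqrt ((4 * r i) powr \<tau>) * sqrt (E i)" if "i \<in> I" for i
  proof -
    have "(W i)\<^sup>2 = (\<Sum>j\<in>G i. \<Sum>k\<in>G i. w j * w k)"
      by (simp add: W_def power2_eq_square sum_product)
    also have "\<dots> \<le> (\<Sum>j\<in>G i. \<Sum>k\<in>G i. (4 * r i) powr \<tau> * (w j * w k * K j k))"
    proof (intro sum_mono)
      fix j k assume jk: "j \<in> G i" "k \<in> G i"
      then have "y j \<in> ball (p i) (r i)" "y k \<in> ball (p i) (r i)"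
        using g[of j] g[of k] by (auto simp: G_def)
      then have "dist (y j) (y k) \<le> 2 * r i"
        using dist_triangle2[of "y j" "y k" "p i"] by (simp add: dist_commute)
      then have "1 \<le> (2 * (2 * r i)) powr \<tau> * K j k"
        unfolding K_def using r[OF that] assms by (intro energy_kernel_ge) auto
      then have "w j * w k * 1 \<le> w j * w k * ((4 * r i) powr \<tau> * K j k)"
        using jk wGJ by (intro mult_left_mono) auto
      then show "w j * w k \<le> (4 * r i) powr \<tau> * (w j * w k * K j k)" by (simp add: mult_ac)
    qed
    also have "\<dots> = (4 * r i) powr \<tau> * E i" by (simp add: E_def sum_distrib_left)
    finally show ?thesis
      by (metis real_le_rsqrt real_sqrt_mult)
  qed
  have "(\<Sum>j\<in>J. w j) = (\<Sum>i\<in>I. W i)"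
    unfolding W_def G_def using assms g by (intro sum.group[symmetric]) auto
  also have "\<dots> \<le> (\<Sum>i\<in>I. sqrt ((4 * r i) powr \<tau>) * sqrt (E i))"
    by (intro sum_mono W_le)
  finally have "(\<Sum>j\<in>J. w j)\<^sup>2 \<le> (\<Sum>i\<in>I. sqrt ((4 * r i) powr \<tau>) * sqrt (E i))\<^sup>2"
    using assms by (intro power_mono sum_nonneg) auto
  also have "\<dots> \<le> (\<Sum>i\<in>I. (sqrt ((4 * r i) powr \<tau>))\<^sup>2) * (\<Sum>i\<in>I. (sqrt (E i))\<^sup>2)"
    by (rule Cauchy_Schwarz_ineq_sum)
  also have "(\<Sum>i\<in>I. (sqrt ((4 * r i) powr \<tau>))\<^sup>2) = (\<Sum>i\<in>I. 4 powr \<tau> * r i powr \<tau>)"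
    using r by (intro sum.cong) (auto simp: powr_mult less_imp_le)
  also have "\<dots> = 4 powr \<tau> * (\<Sum>i\<in>I. r i powr \<tau>)" by (simp add: sum_distrib_left)
  also have "(\<Sum>i\<in>I. (sqrt (E i))\<^sup>2) = (\<Sum>i\<in>I. E i)" using E0 by simp
  also have "4 powr \<tau> * (\<Sum>i\<in>I. r i powr \<tau>) * (\<Sum>i\<in>I. E i) \<le>
      4 powr \<tau> * (\<Sum>i\<in>I. r i powr \<tau>) * (\<Sum>i\<in>J. \<Sum>j\<in>J. w i * w j * K i j)"
  proof (intro mult_left_mono)
    have "(\<Sum>i\<in>I. E i) \<le> (\<Sum>i\<in>I. \<Sum>j\<in>G i. \<Sum>k\<in>J. w j * w k * K j k)"
      unfolding E_def
      by (intro sum_mono sum_mono2 GJ mult_nonneg_nonneg K0 assms(2)) (use assms wGJ in auto)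
    also have "\<dots> = (\<Sum>j\<in>J. \<Sum>k\<in>J. w j * w k * K j k)"
      unfolding G_def using assms g by (intro sum.group) auto
    finally show "(\<Sum>i\<in>I. E i) \<le> (\<Sum>j\<in>J. \<Sum>k\<in>J. w j * w k * K j k)" .
  qed (auto intro!: mult_nonneg_nonneg sum_nonneg)
  finally show ?thesis by (simp add: K_def)
qed

text \<open>
  The measures may live on different finite sets for different \<open>n\<close> and no weak limit is taken:
  compactness reduces a cover to finitely many balls, and then any \<open>n\<close> beyond the smallest radius
  will do.
\<close>

lemma hausdorff_measure_pos_if_bounded_energy:
  fixes B :: "'a::metric_space set"
  assumes B: "compact B" and \<tau>: "\<tau> > 0" and c: "c > 0" and L: "L \<ge> 0"
    and freq: "\<exists>\<^sub>F n in sequentially. \<exists>(J::'j set) w y. finite J \<and> (\<forall>j\<in>J. w j \<ge> 0 \<and> y j \<in> B) \<and>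
      c \<le> (\<Sum>j\<in>J. w j) \<and>
      (\<Sum>i\<in>J. \<Sum>j\<in>J. w i * w j * energy_kernel \<tau> n (dist (y i) (y j))) \<le> L"
  shows "hausdorff_measure \<tau> B \<noteq> 0"
proof
  assume H: "hausdorff_measure \<tau> B = 0"
  \<comment> \<open>\<open>\<epsilon> * Q\<close> is the upper bound reached at the end, and it has
    to fall below \<open>c\<^sup>2\<close>. The factor \<open>2\<close> pays for the enlargement of
    the pieces to balls, and \<open>L + 1\<close> keeps \<open>Q\<close> positive when
    \<open>L = 0\<close>. The other bound on \<epsilon> keeps all radii at most
    \<open>1/2\<close>.\<close>
  define Q where "Q = 4 powr \<tau> * 2 * (L + 1)"
  define \<epsilon> where "\<epsilon> = min ((1/2) powr \<tau> / 2) (c\<^sup>2 / (2 * Q))"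
  have Q: "Q > 0" using L by (auto simp: Q_def)
  have \<epsilon>: "\<epsilon> > 0" "2 * \<epsilon> \<le> (1/2) powr \<tau>" "\<epsilon> * Q < c\<^sup>2"
  proof -
    show "\<epsilon> > 0" using c Q by (auto simp: \<epsilon>_def)
    show "2 * \<epsilon> \<le> (1/2) powr \<tau>" by (auto simp: \<epsilon>_def min_def)
    have "\<epsilon> * Q \<le> c\<^sup>2 / (2 * Q) * Q" using Q by (intro mult_right_mono) (auto simp: \<epsilon>_def)
    also have "\<dots> < c\<^sup>2" using Q c by (simp add: field_simps)
    finally show "\<epsilon> * Q < c\<^sup>2" .
  qed
  obtain U where U: "U \<in> delta_covers 1 B" "(\<Sum>i. diameter_power \<tau> (U i)) < ennreal \<epsilon>"
    using H[unfolded hausdorff_measure_eq_0_iff, rule_format, of 1 \<epsilon>] \<epsilon>(1) by auto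
  define d where "d i = diameter (U i)" for i
  have d0: "d i \<ge> 0" for i using U by (auto simp: d_def delta_covers_def intro: diameter_ge_0)
  have sum_d: "(\<Sum>i\<in>I. d i powr \<tau>) \<le> \<epsilon>" if "finite I" for I
  proof -
    have "ennreal (\<Sum>i\<in>I. d i powr \<tau>) = (\<Sum>i\<in>I. diameter_power \<tau> (U i))"
      using \<tau> by (simp add: diameter_power_pos d_def)
    also have "\<dots> \<le> (\<Sum>i. diameter_power \<tau> (U i))" using that by (intro sum_le_suminf) auto
    also have "\<dots> \<le> ennreal \<epsilon>" using U(2) by simp
    finally show ?thesis using \<epsilon>(1) by simp
  qed
  \<comment> \<open>Summable corrections of total at most \<epsilon>. They make each radius strictly
    larger than the diameter of its piece, so open balls cover \<open>B\<close> and pieces of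
    diameter \<open>0\<close> get a positive radius.\<close>
  define e where "e i = \<epsilon> * (1/2) ^ Suc i" for i :: nat
  have e0: "e i > 0" for i using \<epsilon>(1) by (auto simp: e_def)
  have sum_e: "(\<Sum>i\<in>I. e i) \<le> \<epsilon>" if "finite I" for I
  proof -
    have "(\<Sum>i\<in>I. e i) = \<epsilon> * (\<Sum>i\<in>I. (1/2) ^ Suc i)" by (simp add: e_def sum_distrib_left)
    also have "(\<Sum>i\<in>I. (1/2::real) ^ Suc i) \<le> (\<Sum>i. (1/2) ^ Suc i)"
      using that power_half_series by (intro sum_le_suminf) (auto simp: sums_iff)
    also have "(\<Sum>i. (1/2::real) ^ Suc i) = 1" using power_half_series by (simp add: sums_iff)
    finally show ?thesis using \<epsilon>(1) by simp
  qed
  define r where "r i = (d i powr \<tau> + e i) powr (1/\<tau>)" for i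
  have r_pow: "r i powr \<tau> = d i powr \<tau> + e i" for i
    using \<tau> e0[of i] by (simp add: r_def powr_powr less_imp_le)
  have r_gt: "d i < r i" for i
  proof -
    have "d i = (d i powr \<tau>) powr (1/\<tau>)" using d0[of i] \<tau> by (simp add: powr_powr)
    also have "\<dots> < r i" unfolding r_def using \<tau> e0[of i] by (intro powr_less_mono2) auto
    finally show ?thesis .
  qed
  have r_le: "2 * r i \<le> 1" for i
  proof -
    have "d i powr \<tau> + e i \<le> (1/2) powr \<tau>"
      using sum_d[of "{i}"] sum_e[of "{i}"] \<epsilon>(2) by simp
    then have "r i \<le> ((1/2) powr \<tau>) powr (1/\<tau>)"
      unfolding r_def using \<tau> e0[of i] by (intro powr_mono2) auto
    also have "\<dots> = 1/2" using \<tau> by (simp add: powr_powr)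
    finally show ?thesis by simp
  qed
  define p where "p i = (SOME x. x \<in> U i)" for i
  have "B \<subseteq> (\<Union>i. ball (p i) (r i))"
  proof
    fix x assume "x \<in> B"
    then obtain i where i: "x \<in> U i" using U by (auto simp: delta_covers_def)
    then have "p i \<in> U i" unfolding p_def by (rule someI)
    then have "dist (p i) x \<le> d i"
      using i U unfolding d_def by (intro diameter_bounded_bound) (auto simp: delta_covers_def)
    with r_gt[of i] have "x \<in> ball (p i) (r i)" by simp
    then show "x \<in> (\<Union>i. ball (p i) (r i))" by blast
  qed
  then obtain I where I: "finite I" "B \<subseteq> (\<Union>i\<in>I. ball (p i) (r i))"
    using compactE_image[OF B, of UNIV "\<lambda>i. ball (p i) (r i)"] by auto
  have "\<forall>\<^sub>F n in sequentially. 2 powr - real n \<le> 2 * r i" for i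
  proof -
    have "2 * r i > 0" using r_gt[of i] d0[of i] by simp
    moreover have "(\<lambda>n. 2 powr - real n) \<longlonglongrightarrow> 0"
      by real_asymp
    ultimately have "\<forall>\<^sub>F n in sequentially. 2 powr - real n < 2 * r i"
      by (rule order_tendstoD(2)[rotated])
    then show ?thesis by eventually_elim simp
  qed
  then have "\<forall>\<^sub>F n in sequentially. \<forall>i\<in>I. 2 powr - real n \<le> 2 * r i"
    using I(1) by (intro eventually_ball_finite) auto
  from frequently_ex[OF frequently_eventually_conj[OF freq this]] obtain n and J :: "'j set" and w y where n:
    "\<And>i. i \<in> I \<Longrightarrow> 2 powr - real n \<le> 2 * r i"
    "finite J" "\<And>j. j \<in> J \<Longrightarrow> w j \<ge> 0" "\<And>j. j \<in> J \<Longrightarrow> y j \<in> B" "c \<le> (\<Sum>j\<in>J. w j)"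
    "(\<Sum>i\<in>J. \<Sum>j\<in>J. w i * w j * energy_kernel \<tau> n (dist (y i) (y j))) \<le> L"
    by (elim exE conjE, rule_tac that) auto
  have "c\<^sup>2 \<le> (\<Sum>j\<in>J. w j)\<^sup>2" using c n(5) by (intro power_mono) auto
  also have "\<dots> \<le> 4 powr \<tau> * (\<Sum>i\<in>I. r i powr \<tau>) *
     (\<Sum>i\<in>J. \<Sum>j\<in>J. w i * w j * energy_kernel \<tau> n (dist (y i) (y j)))"
  proof (intro energy_ball_cover \<tau> n I)
    show "0 < r i \<and> 2 * r i \<le> 1 \<and> 2 powr - real n \<le> 2 * r i" if "i \<in> I" for i
      using r_gt[of i] d0[of i] r_le[of i] n(1)[OF that] by auto
    show "\<exists>i\<in>I. y j \<in> ball (p i) (r i)" if "j \<in> J" for j using n(4)[OF that] I(2) by blast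
  qed
  also have "\<dots> \<le> 4 powr \<tau> * (2 * \<epsilon>) * (L + 1)"
  proof (intro mult_mono)
    show "(\<Sum>i\<in>I. r i powr \<tau>) \<le> 2 * \<epsilon>"
      using sum_d[OF I(1)] sum_e[OF I(1)] by (simp add: r_pow sum.distrib)
    show "(\<Sum>i\<in>J. \<Sum>j\<in>J. w i * w j * energy_kernel \<tau> n (dist (y i) (y j))) \<le> L + 1"
      using n(6) by simp
  qed (use \<epsilon>(1) n(3) in \<open>auto intro!: sum_nonneg mult_nonneg_nonneg energy_kernel_nonneg\<close>)
  also have "\<dots> = \<epsilon> * Q" by (simp add: Q_def)
  also have "\<dots> < c\<^sup>2" by (rule \<epsilon>)
  finally show False by simp
qed

section \<open>Flows on trees and a discrete Frostman lemma\<close>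

text \<open>
  The flow is built by rescaling the overloaded blocks, height by height from the leaves upwards. This
  preserves the invariant that every leaf lies in a block whose capacity is attained; the maximal
  such blocks are disjoint and form the cut.
\<close>

lemma tree_capacity_flow:
  fixes J :: "nat set" and cap :: "nat \<Rightarrow> real" and q :: nat
  assumes J: "finite J" and cap: "\<And>h. cap h > 0"
  defines "blk \<equiv> \<lambda>h k. {i\<in>J. i div q ^ h = k}"
  shows "\<exists>w. (\<forall>j. w j \<ge> 0) \<and> (\<forall>h\<le>H. \<forall>k. (\<Sum>i\<in>blk h k. w i) \<le> cap h) \<and>
    (\<forall>j\<in>J. \<exists>h\<le>H. (\<Sum>i\<in>blk h (j div q ^ h). w i) = cap h)"
proof (induction H)
  case 0
  have blk0: "blk 0 k = (if k \<in> J then {k} else {})" for k by (auto simp: blk_def)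
  show ?case using cap by (intro exI[of _ "\<lambda>_. cap 0"]) (auto simp: blk0 less_imp_le)
next
  case (Suc H)
  then obtain w where w: "\<And>j. w j \<ge> 0" "\<And>h k. h \<le> H \<Longrightarrow> (\<Sum>i\<in>blk h k. w i) \<le> cap h"
    "\<And>j. j \<in> J \<Longrightarrow> \<exists>h\<le>H. (\<Sum>i\<in>blk h (j div q ^ h). w i) = cap h" by blast
  define S where "S k = (\<Sum>i\<in>blk (Suc H) k. w i)" for k
  \<comment> \<open>A block at or above capacity is scaled to meet it exactly; dividing is safe
    because \<open>S k\<close> is then at least the positive capacity. Other blocks keep their
    weights.\<close>
  define f where "f k = (if S k \<ge> cap (Suc H) then cap (Suc H) / S k else 1)" for k
  define v where "v j = f (j div q ^ Suc H) * w j" for j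
  have f01: "0 \<le> f k" "f k \<le> 1" for k using cap[of "Suc H"] by (auto simp: f_def)
  have v0: "v j \<ge> 0" for j using f01 w(1) by (auto simp: v_def)
  have v_le: "v j \<le> w j" for j using f01 w(1) by (auto simp: v_def intro: mult_left_le_one_le)
  have S_v: "(\<Sum>i\<in>blk (Suc H) k. v i) = f k * S k" for k
    unfolding S_def sum_distrib_left by (intro sum.cong) (auto simp: v_def blk_def)
  show ?case
  proof (intro exI[of _ v] conjI allI impI ballI)
    show "0 \<le> v j" for j by (rule v0)
  next
    fix h k assume "h \<le> Suc H"
    show "(\<Sum>i\<in>blk h k. v i) \<le> cap h"
    proof (cases "h = Suc H")
      case True
      then show ?thesis using S_v cap[of h] by (auto simp: f_def)
    next
      case False
      have "(\<Sum>i\<in>blk h k. v i) \<le> (\<Sum>i\<in>blk h k. w i)" by (intro sum_mono v_le)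
      then show ?thesis using w(2)[of h k] False \<open>h \<le> Suc H\<close> by simp
    qed
  next
    fix j assume j: "j \<in> J"
    define k where "k = j div q ^ Suc H"
    show "\<exists>h\<le>Suc H. (\<Sum>i\<in>blk h (j div q ^ h). v i) = cap h"
    proof (cases "S k \<ge> cap (Suc H)")
      case True
      then have "(\<Sum>i\<in>blk (Suc H) (j div q ^ Suc H). v i) = cap (Suc H)"
        using S_v[of k] cap[of "Suc H"] by (auto simp: f_def k_def)
      then show ?thesis by blast
    next
      case False
      obtain h where h: "h \<le> H" "(\<Sum>i\<in>blk h (j div q ^ h). w i) = cap h" using w(3)[OF j] by blast
      \<comment> \<open>The saturated block of height \<open>h\<close> lies inside the block
        \<open>k\<close> of height \<open>Suc H\<close>, whose factor is \<open>1\<close>, so it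
        remains saturated.\<close>
      have "(\<Sum>i\<in>blk h (j div q ^ h). v i) = (\<Sum>i\<in>blk h (j div q ^ h). w i)"
      proof (intro sum.cong refl)
        fix i assume "i \<in> blk h (j div q ^ h)"
        then have *: "i div q ^ h = j div q ^ h" by (simp add: blk_def)
        have "Suc H = h + (Suc H - h)" using h by simp
        then have "q ^ Suc H = q ^ h * q ^ (Suc H - h)" by (metis power_add)
        then have "i div q ^ Suc H = k" using * by (simp only: k_def div_mult2_eq)
        then show "v i = w i" using False by (simp add: v_def f_def)
      qed
      then show ?thesis using h by (intro exI[of _ h]) auto
    qed
  qed
qed

text \<open>In this encoding of a \<open>q\<close>-ary tree the leaves are numbers and
  \<open>j div q ^ h\<close> is the ancestor of \<open>j\<close> at height \<open>h\<close>.
  Assigning each leaf to its highest saturated block partitions \<open>J\<close>, so the capacity of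
  the cut is the total flow.\<close>

lemma tree_max_flow_min_cut:
  fixes J :: "nat set" and cap :: "nat \<Rightarrow> real" and q :: nat
  assumes J: "finite J" and cap: "\<And>h. cap h > 0"
  obtains w C where "\<And>j. w j \<ge> 0"
    "\<And>h k. h \<le> H \<Longrightarrow> (\<Sum>i\<in>{i\<in>J. i div q ^ h = k}. w i) \<le> cap h"
    "finite C" "\<And>h k. (h, k) \<in> C \<Longrightarrow> h \<le> H" "\<And>j. j \<in> J \<Longrightarrow> \<exists>h. (h, j div q ^ h) \<in> C"
    "(\<Sum>(h, k)\<in>C. cap h) \<le> (\<Sum>j\<in>J. w j)"
proof -
  define blk where "blk = (\<lambda>h k. {i\<in>J. i div q ^ h = k})"
  obtain w where *: "(\<forall>j. w j \<ge> 0) \<and> (\<forall>h\<le>H. \<forall>k. (\<Sum>i\<in>blk h k. w i) \<le> cap h) \<and>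
      (\<forall>j\<in>J. \<exists>h\<le>H. (\<Sum>i\<in>blk h (j div q ^ h). w i) = cap h)"
    unfolding blk_def by (rule exE[OF tree_capacity_flow[OF J cap, of H q]])
  then have w: "\<And>j. w j \<ge> 0" "\<And>h k. h \<le> H \<Longrightarrow> (\<Sum>i\<in>blk h k. w i) \<le> cap h"
    "\<And>j. j \<in> J \<Longrightarrow> \<exists>h\<le>H. (\<Sum>i\<in>blk h (j div q ^ h). w i) = cap h" by simp_all
  define T where "T j = {h. h \<le> H \<and> (\<Sum>i\<in>blk h (j div q ^ h). w i) = cap h}" for j
  define t where "t j = Max (T j)" for j
  have T: "finite (T j)" for j by (auto simp: T_def)
  have tT: "t j \<in> T j" if "j \<in> J" for j
    unfolding t_def using T w(3)[OF that] by (intro Max_in) (auto simp: T_def)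
  define g where "g j = (t j, j div q ^ t j)" for j
  define C where "C = g ` J"
  \<comment> \<open>If \<open>i\<close> lies in the highest saturated block of \<open>j\<close>,
    that block is saturated for \<open>i\<close> too, so \<open>t j \<le> t i\<close>. By nesting,
    \<open>i\<close> and \<open>j\<close> then share the block of height \<open>t i\<close>, which
    gives the reverse inequality.\<close>
  have same: "g i = g j" if ij: "i \<in> J" "j \<in> J" "i div q ^ t j = j div q ^ t j" for i j
  proof -
    have "t j \<in> T i" using tT[OF ij(2)] ij(3) by (simp add: T_def)
    then have "t j \<le> t i" unfolding t_def[of i] using T by (intro Max_ge)
    then obtain d where d: "t i = t j + d" using le_Suc_ex by blast
    then have eq: "i div q ^ t i = j div q ^ t i" using ij(3) by (simp add: power_add div_mult2_eq)
    then have "t i \<in> T j" using tT[OF ij(1)] by (simp add: T_def)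
    then have "t i \<le> t j" unfolding t_def[of j] using T by (intro Max_ge)
    with \<open>t j \<le> t i\<close> eq show ?thesis by (simp add: g_def)
  qed
  have "(\<Sum>(h, k)\<in>C. cap h) = (\<Sum>c\<in>C. \<Sum>i\<in>{i\<in>J. g i = c}. w i)"
  proof (intro sum.cong refl)
    fix c assume "c \<in> C"
    then obtain j where j: "j \<in> J" "c = g j" by (auto simp: C_def)
    have "{i\<in>J. g i = c} = blk (t j) (j div q ^ t j)"
    proof (intro set_eqI iffI)
      fix i assume "i \<in> {i\<in>J. g i = c}"
      then show "i \<in> blk (t j) (j div q ^ t j)" using j by (auto simp: blk_def g_def)
    next
      fix i assume i: "i \<in> blk (t j) (j div q ^ t j)"
      then have "g i = g j" by (intro same j) (auto simp: blk_def)
      then show "i \<in> {i\<in>J. g i = c}" using i j by (simp add: blk_def)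
    qed
    then show "(case c of (h, k) \<Rightarrow> cap h) = (\<Sum>i\<in>{i\<in>J. g i = c}. w i)"
      using tT[OF j(1)] j(2) by (simp add: T_def g_def)
  qed
  also have "\<dots> = (\<Sum>j\<in>J. w j)" using J by (intro sum.group) (auto simp: C_def)
  finally have sumC: "(\<Sum>(h, k)\<in>C. cap h) = (\<Sum>j\<in>J. w j)" .
  show thesis
  proof (rule that[of w C])
    show "finite C" using J by (simp add: C_def)
    show "h \<le> H" if "(h, k) \<in> C" for h k using that tT by (auto simp: C_def g_def T_def)
    show "\<exists>h. (h, j div q ^ h) \<in> C" if "j \<in> J" for j using that by (auto simp: C_def g_def)
  qed (use w sumC in \<open>auto simp: blk_def\<close>)
qed

text \<open>The leaves are the dyadic intervals of length \<open>2 powr - N\<close> that meet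
  \<open>A\<close>, and the capacity of a block is the \<open>s\<close>-th power of its length. A
  cut covers \<open>A\<close> by intervals, so its capacity is at least the content bound
  \<open>c\<close>, which is fixed before \<open>N\<close>. A ball of radius
  \<open>2 powr - l\<close> meets at most three dyadic intervals of that length, whence the factor
  \<open>3\<close>.\<close>

lemma discrete_frostman:
  fixes A :: "real set"
  assumes A: "A \<subseteq> {0..1}" and s: "s > 0" and H: "hausdorff_measure s A \<noteq> 0"
  obtains c where "c > 0" "\<And>N. \<exists>(J::nat set) w x. finite J \<and> (\<forall>j\<in>J. w j \<ge> 0 \<and> x j \<in> A) \<and>
    c \<le> (\<Sum>j\<in>J. w j) \<and>
    (\<forall>l\<le>N. \<forall>u. (\<Sum>j\<in>{j\<in>J. \<bar>u - x j\<bar> \<le> 2 powr - real l}. w j) \<le> 3 * 2 powr (- s * real l))"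
proof -
  obtain c where c: "c > 0"
    "\<And>(U :: nat \<times> nat \<Rightarrow> real set) C. finite C \<Longrightarrow> A \<subseteq> (\<Union>i\<in>C. U i) \<Longrightarrow>
      (\<And>i. i \<in> C \<Longrightarrow> bounded (U i)) \<Longrightarrow> c \<le> (\<Sum>i\<in>C. diameter (U i) powr s)"
    by (rule hausdorff_content_pos_finite[OF s H]) blast
  show thesis
  proof (rule that[OF c(1)])
    fix N :: nat
    define ix where "ix a = nat \<lfloor>a * 2 ^ N\<rfloor>" for a :: real
    have ix: "real (ix a) \<le> a * 2 ^ N" "a * 2 ^ N < real (ix a) + 1" if "a \<in> A" for a
      using that A by (auto simp: ix_def)
    define J where "J = ix ` A"
    have J: "finite J"
    proof (rule finite_subset)
      \<comment> \<open>The index \<open>2 ^ N\<close> is included because it belongs to the point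
        \<open>1\<close>.\<close>
      show "J \<subseteq> {..2 ^ N}"
      proof
        fix j assume "j \<in> J"
        then obtain a where a: "a \<in> A" "j = ix a" by (auto simp: J_def)
        have "real j \<le> a * 2 ^ N" using ix a by simp
        also have "\<dots> \<le> 1 * 2 ^ N" using a A by (intro mult_right_mono) auto
        finally have "real j \<le> real (2 ^ N)" by simp
        then show "j \<in> {..2 ^ N}" unfolding of_nat_le_iff by simp
      qed
    qed simp
    define x where "x j = (SOME a. a \<in> A \<and> ix a = j)" for j
    have x: "x j \<in> A \<and> ix (x j) = j" if "j \<in> J" for j
      unfolding x_def by (rule someI_ex) (use that in \<open>auto simp: J_def\<close>)
    define cap where "cap h = (2 ^ h / 2 ^ N) powr s" for h :: nat
    have cap: "cap h > 0" for h by (simp add: cap_def)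
    obtain w C where w: "\<And>j. w j \<ge> 0"
      "\<And>h k. h \<le> N \<Longrightarrow> (\<Sum>i\<in>{i\<in>J. i div 2 ^ h = k}. w i) \<le> cap h"
      and C: "finite C" "\<And>j. j \<in> J \<Longrightarrow> \<exists>h. (h, j div 2 ^ h) \<in> C"
      "(\<Sum>(h, k)\<in>C. cap h) \<le> (\<Sum>j\<in>J. w j)"
      by (rule tree_max_flow_min_cut[OF J cap, where q = 2 and H = N]) (rule that; assumption)
    have div_bounds: "real (i div 2 ^ h) * 2 ^ h \<le> real i"
      "real i + 1 \<le> (real (i div 2 ^ h) + 1) * 2 ^ h" for i h :: nat
    proof -
      have "real (i div 2 ^ h * 2 ^ h) \<le> real i" unfolding of_nat_le_iff by simp
      then show "real (i div 2 ^ h) * 2 ^ h \<le> real i" by simp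
      have "i < Suc (i div 2 ^ h) * 2 ^ h" using dividend_less_div_times[of "2 ^ h" i] by simp
      then have "real (i + 1) \<le> real (Suc (i div 2 ^ h) * 2 ^ h)" unfolding of_nat_le_iff by simp
      then show "real i + 1 \<le> (real (i div 2 ^ h) + 1) * 2 ^ h" by (simp add: algebra_simps)
    qed
    define I where "I = (\<lambda>(h::nat, k::nat). {real k * (2 ^ h / 2 ^ N)..(real k + 1) * (2 ^ h / 2 ^ N)})"
    have "c \<le> (\<Sum>p\<in>C. diameter (I p) powr s)"
    proof (rule c(2)[OF C(1)])
      show "A \<subseteq> (\<Union>p\<in>C. I p)"
      proof
        fix a assume a: "a \<in> A"
        then have "ix a \<in> J" by (simp add: J_def)
        then obtain h where h: "(h, ix a div 2 ^ h) \<in> C" using C(2) by blast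
        have "real (ix a div 2 ^ h) * 2 ^ h \<le> a * 2 ^ N" "a * 2 ^ N \<le> (real (ix a div 2 ^ h) + 1) * 2 ^ h"
          using ix[OF a] div_bounds[of "ix a" h] by linarith+
        then have "a \<in> I (h, ix a div 2 ^ h)" by (simp add: I_def field_simps)
        with h show "a \<in> (\<Union>p\<in>C. I p)" by blast
      qed
      show "bounded (I p)" for p by (auto simp: I_def split: prod.splits)
    qed
    also have "(\<Sum>p\<in>C. diameter (I p) powr s) = (\<Sum>(h, k)\<in>C. cap h)"
    proof (intro sum.cong refl)
      fix p assume "p \<in> C"
      obtain h k where p: "p = (h, k)" by (cases p)
      have "diameter (I p) = (real k + 1) * (2 ^ h / 2 ^ N) - real k * (2 ^ h / 2 ^ N)"
      proof -
        have "real k * (2 ^ h / 2 ^ N) \<le> (real k + 1) * (2 ^ h / 2 ^ N)"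
          by (intro mult_right_mono) auto
        then show ?thesis by (simp add: I_def p)
      qed
      also have "\<dots> = 2 ^ h / 2 ^ N" by (simp add: algebra_simps add_divide_distrib)
      finally show "diameter (I p) powr s = (case p of (h, k) \<Rightarrow> cap h)" by (simp add: p cap_def)
    qed
    also note C(3)
    finally have c_le: "c \<le> (\<Sum>j\<in>J. w j)" .
    have ball: "(\<Sum>j\<in>{j\<in>J. \<bar>u - x j\<bar> \<le> 2 powr - real l}. w j) \<le> 3 * 2 powr (- s * real l)"
      if l: "l \<le> N" for l u
    proof -
      define h where "h = N - l"
      define k0 where "k0 = \<lfloor>u * 2 ^ l\<rfloor>"
      \<comment> \<open>The block of the cell containing \<open>u\<close> and its two neighbours. As
        \<open>nat\<close> sends negative numbers to \<open>0\<close>, these indices may coincide,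
        so only \<open>card S \<le> 3\<close> is claimed.\<close>
      define S where "S = {nat (k0 - 1), nat k0, nat (k0 + 1)}"
      have N: "(2::real) ^ N = 2 ^ l * 2 ^ h" using l by (simp add: h_def flip: power_add)
      have "{j\<in>J. \<bar>u - x j\<bar> \<le> 2 powr - real l} \<subseteq> (\<Union>k\<in>S. {i\<in>J. i div 2 ^ h = k})"
      proof
        fix j assume "j \<in> {j\<in>J. \<bar>u - x j\<bar> \<le> 2 powr - real l}"
        then have j: "j \<in> J" "\<bar>u - x j\<bar> \<le> 2 powr - real l" by auto
        define k where "k = j div 2 ^ h"
        have "real k * 2 ^ h \<le> x j * 2 ^ N" "x j * 2 ^ N < (real k + 1) * 2 ^ h"
          using ix[of "x j"] x[OF j(1)] div_bounds[of j h] unfolding k_def by auto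
        then have k: "real k \<le> x j * 2 ^ l" "x j * 2 ^ l < real k + 1"
          by (simp_all add: N flip: mult.assoc)
        have "\<bar>u - x j\<bar> * 2 ^ l \<le> 2 powr - real l * 2 ^ l" using j(2) by (intro mult_right_mono) auto
        also have "\<dots> = 1" by (simp add: powr_minus powr_realpow)
        finally have "\<bar>u * 2 ^ l - x j * 2 ^ l\<bar> \<le> 1"
          by (simp add: abs_mult left_diff_distrib[symmetric])
        moreover have "real_of_int k0 \<le> u * 2 ^ l" "u * 2 ^ l < real_of_int k0 + 1"
          by (auto simp: k0_def)
        ultimately have "real_of_int (int k) < real_of_int (k0 + 2)"
          "real_of_int (k0 - 2) < real_of_int (int k)" using k by auto
        then have "int k < k0 + 2" "k0 - 2 < int k" unfolding of_int_less_iff .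
        then have "k \<in> S" unfolding S_def by auto
        then show "j \<in> (\<Union>k\<in>S. {i\<in>J. i div 2 ^ h = k})" using j by (auto simp: k_def)
      qed
      then have "(\<Sum>j\<in>{j\<in>J. \<bar>u - x j\<bar> \<le> 2 powr - real l}. w j) \<le>
          (\<Sum>j\<in>(\<Union>k\<in>S. {i\<in>J. i div 2 ^ h = k}). w j)"
        using J w(1) by (intro sum_mono2) (auto simp: S_def)
      also have "\<dots> = (\<Sum>k\<in>S. \<Sum>j\<in>{i\<in>J. i div 2 ^ h = k}. w j)"
        using J by (intro sum.UNION_disjoint) (auto simp: S_def)
      also have "\<dots> \<le> (\<Sum>k\<in>S. cap h)" by (intro sum_mono w) (simp add: h_def)
      also have "\<dots> = real (card S) * cap h" by simp
      also have "card S \<le> 3" unfolding S_def by (simp add: card_insert_if)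
      then have "real (card S) * cap h \<le> 3 * cap h" using cap[of h] by (intro mult_right_mono) auto
      also have "cap h = (2 powr - real l) powr s"
        by (simp add: cap_def N powr_minus powr_realpow inverse_eq_divide)
      also have "\<dots> = 2 powr (- s * real l)" by (simp add: powr_powr mult.commute)
      finally show ?thesis .
    qed
    show "\<exists>(J::nat set) w x. finite J \<and> (\<forall>j\<in>J. w j \<ge> 0 \<and> x j \<in> A) \<and> c \<le> (\<Sum>j\<in>J. w j) \<and>
      (\<forall>l\<le>N. \<forall>u. (\<Sum>j\<in>{j\<in>J. \<bar>u - x j\<bar> \<le> 2 powr - real l}. w j) \<le> 3 * 2 powr (- s * real l))"
      using J w(1) x c_le ball by (intro exI[of _ J] exI[of _ w] exI[of _ x]) auto
  qed
qed

section \<open>Hoelder continuity of Brownian paths\<close>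

text \<open>Chaining: \<open>a n t\<close> is the dyadic point of level \<open>n\<close> just left
  of \<open>t\<close>. Increments along successive levels form a geometric series, continuity
  carries the bound to \<open>t\<close>, and for \<open>x\<close>, \<open>y\<close> at distance
  about \<open>2 powr - n\<close> the points of level \<open>n\<close> coincide or are
  adjacent.\<close>

lemma dyadic_increments_imp_holder:
  fixes f :: "real \<Rightarrow> real"
  assumes cont: "continuous_on {0..1} f" and \<gamma>: "\<gamma> > 0"
    and inc: "\<And>n k. n \<ge> N \<Longrightarrow> k < 2 ^ n \<Longrightarrow>
      \<bar>f (real (Suc k) / 2 ^ n) - f (real k / 2 ^ n)\<bar> \<le> 2 powr (- \<gamma> * real n)"
  obtains C where "C > 0" "\<And>x y. x \<in> {0..1} \<Longrightarrow> y \<in> {0..1} \<Longrightarrow> \<bar>x - y\<bar> \<le> (1/2) ^ N \<Longrightarrow>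
    \<bar>f x - f y\<bar> \<le> C * \<bar>x - y\<bar> powr \<gamma>"
proof -
  define \<rho> :: real where "\<rho> = 2 powr (- \<gamma>)"
  have \<rho>: "0 < \<rho>" "\<rho> < 1" using \<gamma> by (auto simp: \<rho>_def powr_less_one)
  have \<rho>_pow: "\<rho> ^ n = 2 powr (- \<gamma> * real n)" for n
    by (simp add: \<rho>_def powr_power mult.commute)
  have inc': "\<bar>f (real (Suc k) / 2 ^ n) - f (real k / 2 ^ n)\<bar> \<le> \<rho> ^ n" if "n \<ge> N" "k < 2 ^ n" for n k
    using inc[OF that] by (simp add: \<rho>_pow)
  define ix where "ix n t = nat \<lfloor>t * 2 ^ n\<rfloor>" for n and t :: real
  define a where "a n t = real (ix n t) / 2 ^ n" for n t
  have ix: "real (ix n t) \<le> t * 2 ^ n" "t * 2 ^ n < real (ix n t) + 1" if "t \<ge> 0" for n t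
    using that by (auto simp: ix_def)
  have ix_le: "real (ix n t) \<le> 2 ^ n" if "t \<in> {0..1}" for n t
  proof -
    have "real (ix n t) \<le> t * 2 ^ n" using ix(1) that by simp
    also have "\<dots> \<le> 1 * 2 ^ n" using that by (intro mult_right_mono) auto
    finally show ?thesis by simp
  qed
  have lt_pow: "k < 2 ^ n" if "real (Suc k) \<le> 2 ^ n" for k n :: nat
  proof -
    have "real (Suc k) \<le> real (2 ^ n)" using that by simp
    then show ?thesis unfolding of_nat_le_iff by simp
  qed
  have step: "\<bar>f (a (Suc n) t) - f (a n t)\<bar> \<le> \<rho> ^ n" if t: "t \<in> {0..1}" and n: "n \<ge> N" for n t
  proof -
    \<comment> \<open>Refining by one level either keeps the dyadic point or moves it one step of
      the finer grid to the right.\<close>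
    have "real (2 * ix n t) < real (ix (Suc n) t) + 1" "real (ix (Suc n) t) < real (2 * ix n t) + 2"
      using ix[of t n] ix[of t "Suc n"] t by auto
    then consider "ix (Suc n) t = 2 * ix n t" | "ix (Suc n) t = Suc (2 * ix n t)" by linarith
    then show ?thesis
    proof cases
      case 1
      then have "a (Suc n) t = a n t" by (simp add: a_def)
      then show ?thesis using \<rho> by simp
    next
      case 2
      have "\<bar>f (real (Suc (2 * ix n t)) / 2 ^ Suc n) - f (real (2 * ix n t) / 2 ^ Suc n)\<bar> \<le> \<rho> ^ Suc n"
        using ix_le[OF t, of "Suc n"] n unfolding 2 by (intro inc' lt_pow) auto
      also have "\<dots> \<le> \<rho> ^ n" using \<rho> by (intro power_decreasing) auto
      finally show ?thesis by (simp add: a_def 2)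
    qed
  qed
  have chain: "\<bar>f (a (n + m) t) - f (a n t)\<bar> \<le> \<rho> ^ n * (1 - \<rho> ^ m) / (1 - \<rho>)"
    if t: "t \<in> {0..1}" and n: "n \<ge> N" for n m t
  proof (induction m)
    case (Suc m)
    have "\<bar>f (a (n + Suc m) t) - f (a n t)\<bar> \<le> \<rho> ^ (n + m) + \<rho> ^ n * (1 - \<rho> ^ m) / (1 - \<rho>)"
      using Suc step[OF t, of "n + m"] n by simp
    also have "\<dots> = \<rho> ^ n * (1 - \<rho> ^ Suc m) / (1 - \<rho>)"
      using \<rho> by (simp add: field_simps power_add)
    finally show ?case .
  qed auto
  have approx: "\<bar>f t - f (a n t)\<bar> \<le> \<rho> ^ n / (1 - \<rho>)" if t: "t \<in> {0..1}" and n: "n \<ge> N" for n t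
  proof -
    have "(\<lambda>m. a (n + m) t) \<longlonglongrightarrow> t"
    proof (rule real_tendsto_sandwich[of "\<lambda>m. t - 1 / 2 ^ (n + m)" _ _ "\<lambda>m. t"])
      show "\<forall>\<^sub>F m in sequentially. t - 1 / 2 ^ (n + m) \<le> a (n + m) t"
      proof (intro always_eventually allI)
        fix m
        have "t - 1 / 2 ^ (n + m) = (t * 2 ^ (n + m) - 1) / 2 ^ (n + m)"
          by (simp add: diff_divide_distrib)
        also have "\<dots> \<le> a (n + m) t"
          unfolding a_def using ix(2)[of t "n + m"] t by (intro divide_right_mono) auto
        finally show "t - 1 / 2 ^ (n + m) \<le> a (n + m) t" .
      qed
      show "\<forall>\<^sub>F m in sequentially. a (n + m) t \<le> t"
        using ix(1)[of t] t by (intro always_eventually allI) (simp add: a_def field_simps)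
      show "(\<lambda>m. t - 1 / 2 ^ (n + m)) \<longlonglongrightarrow> t" by real_asymp
    qed auto
    moreover have "a m t \<in> {0..1}" for m
      using ix_le[OF t, of m] by (simp add: a_def field_simps)
    ultimately have "(\<lambda>m. f (a (n + m) t)) \<longlonglongrightarrow> f t"
      using cont t by (intro continuous_on_tendsto_compose[OF cont]) auto
    then have "(\<lambda>m. \<bar>f (a (n + m) t) - f (a n t)\<bar>) \<longlonglongrightarrow> \<bar>f t - f (a n t)\<bar>"
      by (intro tendsto_intros)
    moreover have "\<bar>f (a (n + m) t) - f (a n t)\<bar> \<le> \<rho> ^ n / (1 - \<rho>)" for m
    proof -
      have "\<rho> ^ n * (1 - \<rho> ^ m) / (1 - \<rho>) \<le> \<rho> ^ n * 1 / (1 - \<rho>)"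
        using \<rho> by (intro divide_right_mono mult_left_mono) auto
      then show ?thesis using chain[OF t n, of m] by simp
    qed
    ultimately show ?thesis by (intro LIMSEQ_le_const2) auto
  qed
  \<comment> \<open>The \<open>3\<close> counts the two approximation errors and the step between
    adjacent points; \<open>2 powr \<gamma>\<close> comes from replacing \<open>2 powr - n\<close>
    by \<open>2 * d\<close>.\<close>
  define C where "C = 3 * 2 powr \<gamma> / (1 - \<rho>)"
  have C: "C > 0" using \<rho> by (auto simp: C_def)
  have main: "\<bar>f x - f y\<bar> \<le> C * \<bar>x - y\<bar> powr \<gamma>"
    if x: "x \<in> {0..1}" and y: "y \<in> {0..1}" and xy: "x < y" "y - x \<le> (1/2) ^ N" for x y
  proof -
    define d where "d = y - x"
    define n where "n = nat \<lfloor>- log 2 d\<rfloor>"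
    have d: "0 < d" "d \<le> 1" using that by (auto simp: d_def)
    have "- log 2 d \<ge> 0" using d by (simp add: log_le_zero_cancel_iff)
    then have n: "real n \<le> - log 2 d" "- log 2 d < real n + 1" by (auto simp: n_def)
    have "log 2 d \<le> log 2 ((1/2) ^ N)" using d xy by (subst log_le_cancel_iff) (auto simp: d_def)
    also have "\<dots> = - real N" by (simp add: log_nat_power log_divide)
    finally have nN: "n \<ge> N" by (simp add: n_def le_nat_floor)
    have "d = 2 powr log 2 d" using d by simp
    also have "\<dots> \<le> 2 powr - real n" using n by (intro powr_mono) auto
    also have "\<dots> = 1 / 2 ^ n" by (simp add: powr_minus powr_realpow divide_inverse)
    finally have "d * 2 ^ n \<le> 1" by (simp add: field_simps)
    then have yx: "y * 2 ^ n \<le> x * 2 ^ n + 1" by (simp add: d_def algebra_simps)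
    have "x * 2 ^ n \<le> y * 2 ^ n" using xy by simp
    moreover have "x \<ge> 0" "y \<ge> 0" using x y by auto
    ultimately have "real (ix n x) < real (ix n y) + 1" "real (ix n y) < real (ix n x) + 2"
      using yx ix[of x n] ix[of y n] by linarith+
    then consider "ix n y = ix n x" | "ix n y = Suc (ix n x)" by linarith
    then have "\<bar>f (a n y) - f (a n x)\<bar> \<le> \<rho> ^ n"
    proof cases
      case 1 then show ?thesis using \<rho> by (simp add: a_def)
    next
      case 2
      show ?thesis unfolding a_def 2 using ix_le[OF y, of n] nN unfolding 2 by (intro inc' lt_pow) auto
    qed
    also have "\<dots> \<le> \<rho> ^ n / (1 - \<rho>)" using \<rho> by (simp add: field_simps)
    finally have "\<bar>f x - f y\<bar> \<le> 3 * (\<rho> ^ n / (1 - \<rho>))"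
      using approx[OF x nN] approx[OF y nN] by linarith
    also have "\<rho> ^ n = (2 powr - real n) powr \<gamma>" by (simp add: \<rho>_pow powr_powr mult.commute)
    also have "\<dots> \<le> (2 * d) powr \<gamma>"
    proof (intro powr_mono2)
      have "2 powr - real n = 2 * 2 powr (- real n - 1)" by (simp add: powr_diff)
      also have "\<dots> \<le> 2 * 2 powr log 2 d" using n by (intro mult_left_mono powr_mono) auto
      also have "\<dots> = 2 * d" using d by simp
      finally show "2 powr - real n \<le> 2 * d" .
    qed (use \<gamma> in auto)
    also have "3 * ((2 * d) powr \<gamma> / (1 - \<rho>)) = C * d powr \<gamma>"
      using d by (simp add: C_def powr_mult)
    finally show ?thesis using \<rho> xy by (simp add: d_def divide_right_mono abs_minus_commute)
  qed
  show thesis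
  proof (rule that[OF C])
    fix x y :: real assume *: "x \<in> {0..1}" "y \<in> {0..1}" "\<bar>x - y\<bar> \<le> (1/2) ^ N"
    consider "x < y" | "y < x" | "x = y" by linarith
    then show "\<bar>f x - f y\<bar> \<le> C * \<bar>x - y\<bar> powr \<gamma>"
    proof cases
      case 1 then show ?thesis using main[of x y] * by simp
    next
      case 2 then show ?thesis using main[of y x] * by (simp add: abs_minus_commute)
    qed auto
  qed
qed

section \<open>Tail and small-ball estimates for centred normal variables\<close>

context prob_space begin

text \<open>Markov's inequality for the moment of order \<open>2 * p\<close>. Leaving
  \<open>p\<close> free allows a decay in \<sigma> / l of any polynomial order.\<close>

lemma normal_moment_tail_bound:
  assumes X: "distributed M lborel X (normal_density 0 \<sigma>)" and \<sigma>: "\<sigma> > 0" and l: "l > 0"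
  shows "prob {\<omega>\<in>space M. l < \<bar>X \<omega>\<bar>} \<le> fact (2 * p) / (2 ^ p * fact p) * (\<sigma> / l) ^ (2 * p)"
proof -
  have [measurable]: "random_variable borel X" using distributed_measurable[OF X] by simp
  have nn: "\<And>x. x \<in> space lborel \<Longrightarrow> 0 \<le> normal_density 0 \<sigma> x" by simp
  note moment = normal_moment_even[OF \<sigma>, of 0 p, simplified]
  have int: "integrable M (\<lambda>\<omega>. X \<omega> ^ (2 * p))"
    using distributed_integrable[OF X _ nn, of "\<lambda>x. x ^ (2 * p)"] moment
    by (auto simp: has_bochner_integral_iff)
  have "(\<integral>\<omega>. X \<omega> ^ (2 * p) \<partial>M) = fact (2 * p) / ((2 / \<sigma>\<^sup>2) ^ p * fact p)"
    using distributed_integral[OF X _ nn, of "\<lambda>x. x ^ (2 * p)"] moment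
    by (auto simp: has_bochner_integral_iff)
  also have "\<dots> = fact (2 * p) / (2 ^ p * fact p) * \<sigma> ^ (2 * p)"
    using \<sigma> by (simp add: power_divide power_mult)
  finally have E: "(\<integral>\<omega>. X \<omega> ^ (2 * p) \<partial>M) = fact (2 * p) / (2 ^ p * fact p) * \<sigma> ^ (2 * p)" .
  have "prob {\<omega>\<in>space M. l < \<bar>X \<omega>\<bar>} \<le> prob {\<omega>\<in>space M. l ^ (2 * p) \<le> X \<omega> ^ (2 * p)}"
  proof (intro finite_measure_mono subsetI)
    fix \<omega> assume "\<omega> \<in> {\<omega>\<in>space M. l < \<bar>X \<omega>\<bar>}"
    then have "\<omega> \<in> space M" "l ^ (2 * p) \<le> \<bar>X \<omega>\<bar> ^ (2 * p)" using l by (auto intro: power_mono)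
    then show "\<omega> \<in> {\<omega>\<in>space M. l ^ (2 * p) \<le> X \<omega> ^ (2 * p)}" by (simp add: power_even_abs)
  qed measurable
  also have "\<dots> \<le> (\<integral>\<omega>. X \<omega> ^ (2 * p) \<partial>M) / l ^ (2 * p)"
    using l int by (intro integral_Markov_inequality_measure[where A = "{}"]) auto
  finally show ?thesis by (simp add: E power_divide)
qed

text \<open>The density is at most \<open>1 / (2 * \<sigma>)\<close>, since
  \<open>4 \<le> 2 * pi\<close>, and the interval has length \<open>2 * l\<close>.\<close>

lemma normal_small_ball_bound:
  assumes X: "distributed M lborel X (normal_density 0 \<sigma>)" and \<sigma>: "\<sigma> > 0" and l: "l \<ge> 0"
  shows "prob {\<omega>\<in>space M. \<bar>X \<omega>\<bar> \<le> l} \<le> l / \<sigma>"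
proof -
  have "emeasure M (X -` {- l..l} \<inter> space M) =
      (\<integral>\<^sup>+x. ennreal (normal_density 0 \<sigma> x) * indicator {- l..l} x \<partial>lborel)"
    by (rule distributed_emeasure[OF X]) simp
  also have "\<dots> \<le> (\<integral>\<^sup>+x. ennreal (1 / (2 * \<sigma>)) * indicator {- l..l} x \<partial>lborel)"
  proof (intro nn_integral_mono mult_right_mono ennreal_leI)
    fix x
    have "(2 * \<sigma>)\<^sup>2 \<le> 2 * pi * \<sigma>\<^sup>2" using pi_gt3 by (simp add: power2_eq_square mult_right_mono)
    then have "2 * \<sigma> \<le> sqrt (2 * pi * \<sigma>\<^sup>2)" using \<sigma> by (intro real_le_rsqrt)
    then have "1 / sqrt (2 * pi * \<sigma>\<^sup>2) \<le> 1 / (2 * \<sigma>)" using \<sigma> by (intro divide_left_mono) auto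
    moreover have "exp (- (x - 0)\<^sup>2 / (2 * \<sigma>\<^sup>2)) \<le> 1" by simp
    ultimately have "1 / sqrt (2 * pi * \<sigma>\<^sup>2) * exp (- (x - 0)\<^sup>2 / (2 * \<sigma>\<^sup>2)) \<le> 1 / (2 * \<sigma>) * 1"
      using \<sigma> by (intro mult_mono) auto
    then show "normal_density 0 \<sigma> x \<le> 1 / (2 * \<sigma>)" by (simp add: normal_density_def)
  qed auto
  also have "\<dots> = ennreal (1 / (2 * \<sigma>)) * ennreal (2 * l)"
    using l by (simp add: nn_integral_cmult_indicator)
  also have "\<dots> = ennreal (l / \<sigma>)" using \<sigma> l by (simp add: ennreal_mult[symmetric])
  also have "X -` {- l..l} \<inter> space M = {\<omega>\<in>space M. \<bar>X \<omega>\<bar> \<le> l}" by auto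
  finally show ?thesis using \<sigma> l by (simp add: emeasure_eq_measure)
qed

end

section \<open>Almost sure Hoelder regularity and the upper bound for the dimension of the
  image\<close>

context brownian_motion begin

text \<open>A union bound over the \<open>2 ^ n\<close> increments of level \<open>n\<close>,
  combined with a moment of sufficiently high order, gives summable probabilities, and
  Borel-Cantelli applies.\<close>

lemma AE_dyadic_increments:
  assumes "\<gamma> < 1 / 2"
  shows "AE \<omega> in M. \<forall>\<^sub>F n in sequentially. \<forall>k<2 ^ n.
    \<bar>b (real (Suc k) / 2 ^ n) \<omega> - b (real k / 2 ^ n) \<omega>\<bar> \<le> 2 powr (- \<gamma> * real n)"
proof -
  \<comment> \<open>The probability at level \<open>n\<close> is of order
    \<open>2 powr (n * (1 - p * (1 - 2 * \<gamma>)))\<close>; this choice makes the exponent at most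
    \<open>- n\<close>.\<close>
  obtain p :: nat where p: "real p * (1 - 2 * \<gamma>) \<ge> 2"
  proof -
    obtain p :: nat where "2 / (1 - 2 * \<gamma>) \<le> real p" using real_arch_simple by blast
    then show ?thesis using assms by (intro that[of p]) (simp add: field_simps)
  qed
  define D where "D n k \<omega> = b (real (Suc k) / 2 ^ n) \<omega> - b (real k / 2 ^ n) \<omega>" for n k \<omega>
  define bad where
    "bad n = (\<Union>k<2 ^ n. {\<omega>\<in>space M. 2 powr (- \<gamma> * real n) < \<bar>D n k \<omega>\<bar>})" for n :: nat
  define c :: real where "c = fact (2 * p) / (2 ^ p * fact p)"
  have rng: "real k / 2 ^ n \<in> {0..1}" "real (Suc k) / 2 ^ n \<in> {0..1}" if "k < 2 ^ n" for k n :: nat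
  proof -
    have "real (Suc k) \<le> real (2 ^ n)" using that unfolding of_nat_le_iff by simp
    then show "real (Suc k) / 2 ^ n \<in> {0..1}" by simp
    show "real k / 2 ^ n \<in> {0..1}" using that by simp
  qed
  have meas: "random_variable borel (D n k)" if "k < 2 ^ n" for n k
    unfolding D_def using rng[OF that] by (intro borel_measurable_diff measurable_b)
  have sets: "{\<omega>\<in>space M. 2 powr (- \<gamma> * real n) < \<bar>D n k \<omega>\<bar>} \<in> events" if "k < 2 ^ n" for n k
    using meas[OF that] by measurable
  have bad_sets: "bad n \<in> events" for n unfolding bad_def by (intro sets.finite_UN sets) auto
  have bad_le: "prob (bad n) \<le> c * (1 / 2) ^ n" for n
  proof -
    have "prob (bad n) \<le> (\<Sum>k<2 ^ n. prob {\<omega>\<in>space M. 2 powr (- \<gamma> * real n) < \<bar>D n k \<omega>\<bar>})"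
      unfolding bad_def by (intro finite_measure_subadditive_finite image_subsetI sets) auto
    also have "\<dots> \<le> (\<Sum>k<(2::nat) ^ n. c * (sqrt (1 / 2 ^ n) / 2 powr (- \<gamma> * real n)) ^ (2 * p))"
    proof (intro sum_mono)
      fix k :: nat assume "k \<in> {..<2 ^ n}"
      then have k: "k < 2 ^ n" by simp
      have "distributed M lborel (D n k)
          (normal_density 0 (sqrt (real (Suc k) / 2 ^ n - real k / 2 ^ n)))"
        unfolding D_def using rng[OF k]
        by (intro normal_increments) (auto simp: divide_strict_right_mono)
      also have "real (Suc k) / 2 ^ n - real k / 2 ^ n = 1 / 2 ^ n"
        by (simp add: field_simps)
      finally show "prob {\<omega>\<in>space M. 2 powr (- \<gamma> * real n) < \<bar>D n k \<omega>\<bar>} \<le>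
          c * (sqrt (1 / 2 ^ n) / 2 powr (- \<gamma> * real n)) ^ (2 * p)"
        unfolding c_def by (intro normal_moment_tail_bound) auto
    qed
    also have "\<dots> = c * (2 ^ n * (sqrt (1 / 2 ^ n) / 2 powr (- \<gamma> * real n)) ^ (2 * p))"
      by simp
    finally have *: "prob (bad n) \<le> \<dots>" .
    have "2 ^ n * (sqrt (1 / 2 ^ n) / 2 powr (- \<gamma> * real n)) ^ (2 * p) =
        2 powr (real n * (1 - real p * (1 - 2 * \<gamma>)))"
    proof -
      have "1 / 2 ^ n = (2::real) powr (- real n)" by (simp add: powr_minus powr_realpow divide_inverse)
      then have "sqrt (1 / 2 ^ n) = 2 powr (- real n / 2)"
        by (simp add: powr_half_sqrt[symmetric] powr_powr)
      then have "sqrt (1 / 2 ^ n) / 2 powr (- \<gamma> * real n) = 2 powr (- real n / 2 + \<gamma> * real n)"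
        by (simp add: powr_diff[symmetric])
      then have "2 ^ n * (sqrt (1 / 2 ^ n) / 2 powr (- \<gamma> * real n)) ^ (2 * p) =
          2 powr real n * (2 powr (- real n / 2 + \<gamma> * real n)) ^ (2 * p)"
        by (simp add: powr_realpow)
      also have "(2 powr (- real n / 2 + \<gamma> * real n)) ^ (2 * p) =
          (2 powr (- real n / 2 + \<gamma> * real n)) powr real (2 * p)"
        by (rule powr_realpow[symmetric]) simp
      also have "2 powr real n * \<dots> = 2 powr (real n + (- real n / 2 + \<gamma> * real n) * real (2 * p))"
        unfolding powr_powr by (rule powr_add[symmetric])
      also have "real n + (- real n / 2 + \<gamma> * real n) * real (2 * p) =
          real n * (1 - real p * (1 - 2 * \<gamma>))"
        by (simp add: algebra_simps)
      finally show ?thesis .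
    qed
    also have "\<dots> \<le> 2 powr (- real n)"
    proof (rule powr_mono)
      have "real n * (1 - real p * (1 - 2 * \<gamma>)) \<le> real n * - 1"
        using p by (intro mult_left_mono) linarith+
      then show "real n * (1 - real p * (1 - 2 * \<gamma>)) \<le> - real n" by simp
    qed simp
    also have "\<dots> = (1 / 2) ^ n" by (simp add: powr_minus powr_realpow power_one_over inverse_eq_divide)
    finally have "c * (2 ^ n * (sqrt (1 / 2 ^ n) / 2 powr (- \<gamma> * real n)) ^ (2 * p)) \<le> c * (1 / 2) ^ n"
      by (intro mult_left_mono) (simp_all add: c_def)
    with * show ?thesis by (rule order_trans)
  qed
  have "summable (\<lambda>n. c * (1 / 2) ^ n)" by (intro summable_mult summable_geometric) simp
  then have "summable (\<lambda>n. prob (bad n))"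
    by (rule summable_comparison_test'[where N = 0]) (use bad_le in simp)
  then have "AE \<omega> in M. \<forall>\<^sub>F n in sequentially. \<omega> \<in> space M - bad n"
    by (intro borel_cantelli_AE1 bad_sets) (auto simp: emeasure_eq_measure)
  then show ?thesis
  proof eventually_elim
    case (elim \<omega>)
    then show ?case
    proof eventually_elim
      case (elim n)
      then show ?case by (auto simp: bad_def D_def not_less)
    qed
  qed
qed

text \<open>The level from which the dyadic bounds hold depends on the path, so \<delta> is random;
  this is harmless because Hausdorff measure is determined by arbitrarily fine covers.\<close>

lemma AE_locally_holder:
  assumes "0 < \<gamma>" "\<gamma> < 1 / 2"
  shows "AE \<omega> in M. \<exists>\<delta>>0. \<exists>C>0. \<forall>x\<in>{0..1}. \<forall>y\<in>{0..1}. \<bar>x - y\<bar> \<le> \<delta> \<longrightarrow>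
    \<bar>b x \<omega> - b y \<omega>\<bar> \<le> C * \<bar>x - y\<bar> powr \<gamma>"
  using AE_dyadic_increments[OF assms(2)] continuous_paths
proof eventually_elim
  case (elim \<omega>)
  obtain N where N: "\<And>n k. n \<ge> N \<Longrightarrow> k < 2 ^ n \<Longrightarrow>
      \<bar>b (real (Suc k) / 2 ^ n) \<omega> - b (real k / 2 ^ n) \<omega>\<bar> \<le> 2 powr (- \<gamma> * real n)"
    using elim(1) unfolding eventually_sequentially by blast
  show ?case
  proof (rule dyadic_increments_imp_holder[OF elim(2) assms(1) N])
    fix C assume "C > 0" "\<And>x y. x \<in> {0..1} \<Longrightarrow> y \<in> {0..1} \<Longrightarrow> \<bar>x - y\<bar> \<le> (1 / 2) ^ N \<Longrightarrow>
      \<bar>b x \<omega> - b y \<omega>\<bar> \<le> C * \<bar>x - y\<bar> powr \<gamma>"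
    then show ?thesis by (intro exI[of _ "(1 / 2) ^ N"] exI[of _ C] conjI) auto
  qed
qed

lemma AE_hausdorff_dim_image_le:
  assumes A: "A \<subseteq> {0..1}"
  shows "AE \<omega> in M. hausdorff_dim ((\<lambda>t. b t \<omega>) ` A) \<le> 2 * hausdorff_dim A"
proof -
  \<comment> \<open>A sequence tending to \<open>1/2\<close>, so that one null set serves all
    exponents; the shift by \<open>3\<close> makes already \<open>\<gamma> 0\<close>
    positive.\<close>
  define \<gamma> where "\<gamma> k = 1 / 2 - 1 / real (k + 3)" for k :: nat
  have \<gamma>: "0 < \<gamma> k" "\<gamma> k < 1 / 2" for k by (auto simp: \<gamma>_def field_simps)
  have "AE \<omega> in M. \<forall>k. \<exists>\<delta>>0. \<exists>C>0. \<forall>x\<in>{0..1}. \<forall>y\<in>{0..1}. \<bar>x - y\<bar> \<le> \<delta> \<longrightarrow>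
      \<bar>b x \<omega> - b y \<omega>\<bar> \<le> C * \<bar>x - y\<bar> powr \<gamma> k"
    using AE_locally_holder[OF \<gamma>] by (simp add: AE_all_countable)
  then show ?thesis
  proof eventually_elim
    case (elim \<omega>)
    let ?D = "hausdorff_dim ((\<lambda>t. b t \<omega>) ` A)"
    have "?D \<le> 2 * ennreal s" if s: "s \<ge> 0" "hausdorff_measure s A = 0" for s
    proof (rule LIMSEQ_le_const)
      have "(\<lambda>k. s / \<gamma> k) \<longlonglongrightarrow> 2 * s" unfolding \<gamma>_def by real_asymp
      then have "(\<lambda>k. ennreal (s / \<gamma> k)) \<longlonglongrightarrow> ennreal (2 * s)" by (rule tendsto_ennrealI)
      then show "(\<lambda>k. ennreal (s / \<gamma> k)) \<longlonglongrightarrow> 2 * ennreal s" using s by (simp add: ennreal_mult)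
      have "?D \<le> ennreal (s / \<gamma> k)" for k
      proof -
        obtain \<delta> C where "\<delta> > 0" "C > 0" and holder:
          "\<forall>x\<in>{0..1}. \<forall>y\<in>{0..1}. \<bar>x - y\<bar> \<le> \<delta> \<longrightarrow> \<bar>b x \<omega> - b y \<omega>\<bar> \<le> C * \<bar>x - y\<bar> powr \<gamma> k"
          using elim by blast
        then have "hausdorff_measure (s / \<gamma> k) ((\<lambda>t. b t \<omega>) ` A) = 0"
          using s \<gamma> A
          by (intro hausdorff_measure_holder_image[where d = \<delta> and C = C])
            (auto simp: dist_real_def subset_iff)
        then show ?thesis using s \<gamma>[of k] by (intro hausdorff_dim_le) auto
      qed
      then show "\<exists>N. \<forall>k\<ge>N. ?D \<le> ennreal (s / \<gamma> k)" by blast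
    qed
    note le = this
    show ?case
    proof (rule ennreal_le_epsilon)
      fix e :: real assume fin: "2 * hausdorff_dim A < top" and e: "e > 0"
      have "hausdorff_dim A \<noteq> top" using fin by auto
      then have "hausdorff_dim A < hausdorff_dim A + ennreal (e / 2)"
        using e by (cases "hausdorff_dim A") (auto simp: ennreal_less_iff simp flip: ennreal_plus)
      then obtain s where s: "s \<ge> 0" "hausdorff_measure s A = 0"
        "ennreal s < hausdorff_dim A + ennreal (e / 2)"
        unfolding hausdorff_dim_def[of A] INF_less_iff by blast
      have "?D \<le> 2 * ennreal s" by (rule le[OF s(1,2)])
      also have "\<dots> \<le> 2 * (hausdorff_dim A + ennreal (e / 2))"
        using s(3) by (intro mult_left_mono) auto
      also have "\<dots> = 2 * hausdorff_dim A + ennreal (2 * (e / 2))"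
        using e by (subst ennreal_mult) (auto simp: distrib_left)
      finally show "?D \<le> 2 * hausdorff_dim A + ennreal e" by simp
    qed
  qed
qed

end

section \<open>Energies of Brownian images\<close>

lemma sum_powr_geometric_le:
  fixes a :: real
  assumes "a < 0"
  shows "(\<Sum>m\<le>n. 2 powr (a * real m)) \<le> 1 / (1 - 2 powr a)"
proof -
  have a: "2 powr a < 1" using assms by (simp add: powr_less_one)
  have "(\<Sum>m\<le>n. 2 powr (a * real m)) = (\<Sum>m\<le>n. (2 powr a) ^ m)"
    by (simp add: powr_power mult.commute)
  also have "\<dots> \<le> (\<Sum>m. (2 powr a) ^ m)"
    using a by (intro sum_le_suminf summable_geometric) auto
  also have "\<dots> = 1 / (1 - 2 powr a)" using a by (intro suminf_geometric) auto
  finally show ?thesis .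
qed

text \<open>Exchanging the sums turns the potential at \<open>u\<close> into a sum over scales of
  ball masses, with terms at most \<open>c * 2 powr ((\<theta> - s) * l)\<close>. As
  \<open>\<theta> < s\<close>, the bound does not depend on \<open>N\<close>.\<close>

lemma frostman_potential_le:
  fixes x :: "'j \<Rightarrow> real"
  assumes "finite J" "\<And>j. j \<in> J \<Longrightarrow> w j \<ge> 0" "\<theta> < s"
    and ball: "\<And>l. l \<le> N \<Longrightarrow>
      (\<Sum>j\<in>{j\<in>J. \<bar>u - x j\<bar> \<le> 2 powr - real l}. w j) \<le> c * 2 powr (- s * real l)"
  shows "(\<Sum>j\<in>J. w j * energy_kernel \<theta> N \<bar>u - x j\<bar>) \<le> c / (1 - 2 powr (\<theta> - s))"
proof -
  have "0 \<le> (\<Sum>j\<in>{j\<in>J. \<bar>u - x j\<bar> \<le> 2 powr - real 0}. w j)"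
    using assms by (intro sum_nonneg) auto
  also have "\<dots> \<le> c" using ball[of 0] by simp
  finally have c: "c \<ge> 0" .
  have "(\<Sum>j\<in>J. w j * energy_kernel \<theta> N \<bar>u - x j\<bar>) =
      (\<Sum>l\<le>N. \<Sum>j\<in>J. w j * (if \<bar>u - x j\<bar> \<le> 2 powr - real l then 2 powr (\<theta> * real l) else 0))"
    unfolding energy_kernel_def sum_distrib_left by (rule sum.swap)
  also have "\<dots> = (\<Sum>l\<le>N. 2 powr (\<theta> * real l) * (\<Sum>j\<in>{j\<in>J. \<bar>u - x j\<bar> \<le> 2 powr - real l}. w j))"
  proof (intro sum.cong refl)
    fix l
    have "(\<Sum>j\<in>J. w j * (if \<bar>u - x j\<bar> \<le> 2 powr - real l then 2 powr (\<theta> * real l) else 0)) =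
        (\<Sum>j\<in>J. if \<bar>u - x j\<bar> \<le> 2 powr - real l then 2 powr (\<theta> * real l) * w j else 0)"
      by (intro sum.cong) auto
    also have "\<dots> = (\<Sum>j\<in>{j\<in>J. \<bar>u - x j\<bar> \<le> 2 powr - real l}. 2 powr (\<theta> * real l) * w j)"
      using assms(1) by (rule sum.inter_filter[symmetric])
    finally show "(\<Sum>j\<in>J. w j * (if \<bar>u - x j\<bar> \<le> 2 powr - real l then 2 powr (\<theta> * real l) else 0)) =
        2 powr (\<theta> * real l) * (\<Sum>j\<in>{j\<in>J. \<bar>u - x j\<bar> \<le> 2 powr - real l}. w j)"
      by (simp add: sum_distrib_left)
  qed
  also have "\<dots> \<le> (\<Sum>l\<le>N. 2 powr (\<theta> * real l) * (c * 2 powr (- s * real l)))"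
    by (intro sum_mono mult_left_mono ball) auto
  also have "\<dots> = c * (\<Sum>l\<le>N. 2 powr ((\<theta> - s) * real l))"
  proof -
    have *: "2 powr (\<theta> * real l) * (c * 2 powr (- s * real l)) = c * 2 powr ((\<theta> - s) * real l)" for l
    proof -
      have "(\<theta> - s) * real l = \<theta> * real l + - s * real l" by (simp add: algebra_simps)
      then show ?thesis by (simp only: powr_add mult_ac)
    qed
    show ?thesis unfolding * sum_distrib_left ..
  qed
  also have "\<dots> \<le> c * (1 / (1 - 2 powr (\<theta> - s)))"
    using c assms by (intro mult_left_mono sum_powr_geometric_le) auto
  finally show ?thesis by simp
qed

text \<open>By Fatou the lower limit has finite expectation, hence is almost surely finite, and any
  number above it bounds infinitely many terms. Both \<open>L\<close> and the subsequence depend on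
  the path.\<close>

lemma (in prob_space) AE_frequently_bounded:
  fixes X :: "nat \<Rightarrow> 'a \<Rightarrow> real"
  assumes int: "\<And>n. integrable M (X n)" and nn: "\<And>n \<omega>. 0 \<le> X n \<omega>"
    and C: "\<And>n. expectation (X n) \<le> C"
  shows "AE \<omega> in M. \<exists>L\<ge>0. \<exists>\<^sub>F n in sequentially. X n \<omega> \<le> L"
proof -
  have [measurable]: "X n \<in> borel_measurable M" for n using int by auto
  have "(\<integral>\<^sup>+\<omega>. liminf (\<lambda>n. ennreal (X n \<omega>)) \<partial>M) \<le> liminf (\<lambda>n. \<integral>\<^sup>+\<omega>. ennreal (X n \<omega>) \<partial>M)"
    by (intro nn_integral_liminf) measurable
  also have "\<dots> \<le> ennreal C"
    using C by (intro Liminf_le always_eventually allI)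
      (auto simp: nn_integral_eq_integral[OF int] nn intro: ennreal_leI)
  finally have "(\<integral>\<^sup>+\<omega>. liminf (\<lambda>n. ennreal (X n \<omega>)) \<partial>M) \<noteq> \<infinity>"
    by (auto simp: top_unique)
  then have "AE \<omega> in M. liminf (\<lambda>n. ennreal (X n \<omega>)) \<noteq> \<infinity>"
    by (intro nn_integral_PInf_AE) measurable
  then show ?thesis
  proof eventually_elim
    case (elim \<omega>)
    then obtain l where l: "l \<ge> 0" "liminf (\<lambda>n. ennreal (X n \<omega>)) = ennreal l"
      by (cases "liminf (\<lambda>n. ennreal (X n \<omega>))") auto
    have "\<exists>\<^sub>F n in sequentially. X n \<omega> \<le> l + 1"
    proof (rule ccontr)
      assume "\<not> (\<exists>\<^sub>F n in sequentially. X n \<omega> \<le> l + 1)"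
      then have "\<forall>\<^sub>F n in sequentially. ennreal (l + 1) \<le> ennreal (X n \<omega>)"
        unfolding frequently_def by (auto elim!: eventually_mono intro!: ennreal_leI)
      then have "ennreal (l + 1) \<le> liminf (\<lambda>n. ennreal (X n \<omega>))" by (rule Liminf_bounded)
      with l show False by simp
    qed
    then show ?case using l by (intro exI[of _ "l + 1"]) auto
  qed
qed

section \<open>Expected energies of the image and the lower bound for its dimension\<close>

context brownian_motion begin

text \<open>A power \<beta> of the spatial scale is paid for by the power \<beta> / 2 of the time
  distance; this is the source of the factor \<open>2\<close> in the lower bound.\<close>

lemma prob_increment_small_le:
  assumes xy: "x \<in> {0..1}" "y \<in> {0..1}" "x \<noteq> y" and r: "r > 0" and \<beta>: "0 \<le> \<beta>" "\<beta> \<le> 1"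
  shows "prob {\<omega>\<in>space M. \<bar>b x \<omega> - b y \<omega>\<bar> \<le> r} \<le> r powr \<beta> * \<bar>x - y\<bar> powr (- \<beta> / 2)"
proof -
  have *: "prob {\<omega>\<in>space M. \<bar>b x \<omega> - b y \<omega>\<bar> \<le> r} \<le> r powr \<beta> * \<bar>x - y\<bar> powr (- \<beta> / 2)"
    if "x \<in> {0..1}" "y \<in> {0..1}" "y < x" for x y
  proof -
    define v where "v = r / sqrt (x - y)"
    have v: "v > 0" using r that by (auto simp: v_def)
    have "distributed M lborel (\<lambda>\<omega>. b x \<omega> - b y \<omega>) (normal_density 0 (sqrt (x - y)))"
      using that by (intro normal_increments) auto
    then have "prob {\<omega>\<in>space M. \<bar>b x \<omega> - b y \<omega>\<bar> \<le> r} \<le> v"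
      unfolding v_def using that r by (intro normal_small_ball_bound) auto
    moreover have "prob {\<omega>\<in>space M. \<bar>b x \<omega> - b y \<omega>\<bar> \<le> r} \<le> 1" by simp
    \<comment> \<open>This interpolation makes the sum over the scales a convergent geometric series.\<close>
    moreover have "min v 1 \<le> v powr \<beta>"
    proof (cases "v \<le> 1")
      case True
      then have "v powr 1 \<le> v powr \<beta>" using v \<beta> by (intro powr_mono') auto
      then show ?thesis using v by simp
    next
      case False
      then show ?thesis using \<beta> by (simp add: ge_one_powr_ge_zero min_le_iff_disj)
    qed
    ultimately have "prob {\<omega>\<in>space M. \<bar>b x \<omega> - b y \<omega>\<bar> \<le> r} \<le> v powr \<beta>" by linarith
    also have "v = r * (x - y) powr - (1 / 2)"
    proof -
      have "(x - y) powr - (1 / 2) = inverse (sqrt (x - y))"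
        unfolding powr_minus using that by (simp add: powr_half_sqrt)
      then show ?thesis by (simp add: v_def field_simps)
    qed
    also have "\<dots> powr \<beta> = r powr \<beta> * \<bar>x - y\<bar> powr (- \<beta> / 2)"
      using that r by (simp add: powr_mult powr_powr)
    finally show ?thesis .
  qed
  show ?thesis
  proof (cases "y < x")
    case True then show ?thesis using * xy by simp
  next
    case False then show ?thesis using *[of y x] xy by (simp add: abs_minus_commute)
  qed
qed

text \<open>By Brownian scaling the spatial truncation at \<open>2 powr - n\<close> corresponds to
  the time scale \<open>2 powr - (2 * n)\<close>, which is why the time distance is bounded below by
  it. The case \<open>x = y\<close> is thereby included.\<close>

lemma
  assumes xy: "x \<in> {0..1}" "y \<in> {0..1}" and \<beta>: "0 \<le> \<beta>" "\<beta> \<le> 1" "\<tau> < \<beta>"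
  shows integrable_energy_kernel: "integrable M (\<lambda>\<omega>. energy_kernel \<tau> n \<bar>b x \<omega> - b y \<omega>\<bar>)"
    and expectation_energy_kernel_le: "expectation (\<lambda>\<omega>. energy_kernel \<tau> n \<bar>b x \<omega> - b y \<omega>\<bar>) \<le>
      max \<bar>x - y\<bar> (2 powr - real (2 * n)) powr (- \<beta> / 2) / (1 - 2 powr (\<tau> - \<beta>))"
proof -
  define D where "D = max \<bar>x - y\<bar> (2 powr - real (2 * n))"
  define S where "S m = {\<omega>\<in>space M. \<bar>b x \<omega> - b y \<omega>\<bar> \<le> 2 powr - real m}" for m :: nat
  have [measurable]: "random_variable borel (b x)" "random_variable borel (b y)"
    using measurable_b xy by auto
  have S[measurable]: "S m \<in> events" for m unfolding S_def by measurable
  have D: "D > 0" by (simp add: D_def less_max_iff_disj)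
  have K_eq: "energy_kernel \<tau> n \<bar>b x \<omega> - b y \<omega>\<bar> = (\<Sum>m\<le>n. 2 powr (\<tau> * real m) * indicator (S m) \<omega>)"
    if "\<omega> \<in> space M" for \<omega>
    unfolding energy_kernel_def using that by (intro sum.cong) (auto simp: S_def)
  have int: "integrable M (\<lambda>\<omega>. \<Sum>m\<le>n. 2 powr (\<tau> * real m) * indicator (S m) \<omega>)"
    by (intro Bochner_Integration.integrable_sum integrable_mult_right integrable_real_indicator S)
      (auto simp: emeasure_eq_measure)
  show "integrable M (\<lambda>\<omega>. energy_kernel \<tau> n \<bar>b x \<omega> - b y \<omega>\<bar>)"
    using int by (subst Bochner_Integration.integrable_cong[OF refl K_eq]) auto
  have prob_S: "prob (S m) \<le> 2 powr (- \<beta> * real m) * D powr (- \<beta> / 2)" if m: "m \<le> n" for m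
  proof (cases "\<bar>x - y\<bar> \<ge> 2 powr - real (2 * n)")
    case True
    then have "\<bar>x - y\<bar> > 0" by (smt (verit) powr_gt_zero)
    then have "x \<noteq> y" by auto
    then have "prob (S m) \<le> (2 powr - real m) powr \<beta> * \<bar>x - y\<bar> powr (- \<beta> / 2)"
      unfolding S_def using xy \<beta> by (intro prob_increment_small_le) auto
    then show ?thesis using True by (simp add: powr_powr D_def mult.commute)
  next
    case False
    \<comment> \<open>Below the truncation scale the trivial bound suffices:
      \<open>D powr (- \<beta> / 2)\<close> equals \<open>2 powr (\<beta> * n)\<close>, and
      \<open>m \<le> n\<close>.\<close>
    have "prob (S m) \<le> 2 powr 0" by simp
    also have "\<dots> \<le> 2 powr (- \<beta> * real m + \<beta> * real n)"
      using m \<beta> by (intro powr_mono) (auto simp: mult_left_mono)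
    also have "\<dots> = 2 powr (- \<beta> * real m) * D powr (- \<beta> / 2)"
    proof -
      have "D powr (- \<beta> / 2) = 2 powr (\<beta> * real n)"
        using False by (simp add: D_def powr_powr mult.commute)
      then show ?thesis by (simp only: powr_add)
    qed
    finally show ?thesis .
  qed
  have "expectation (\<lambda>\<omega>. energy_kernel \<tau> n \<bar>b x \<omega> - b y \<omega>\<bar>) =
      expectation (\<lambda>\<omega>. \<Sum>m\<le>n. 2 powr (\<tau> * real m) * indicator (S m) \<omega>)"
    using K_eq by (intro Bochner_Integration.integral_cong) auto
  also have "\<dots> = (\<Sum>m\<le>n. expectation (\<lambda>\<omega>. 2 powr (\<tau> * real m) * indicator (S m) \<omega>))"
    by (intro Bochner_Integration.integral_sum integrable_mult_right integrable_real_indicator S)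
      (auto simp: emeasure_eq_measure)
  also have "\<dots> = (\<Sum>m\<le>n. 2 powr (\<tau> * real m) * prob (S m))"
    using S by (intro sum.cong) (auto simp: sets.sets_into_space Int_absorb2)
  also have "\<dots> \<le> (\<Sum>m\<le>n. 2 powr (\<tau> * real m) * (2 powr (- \<beta> * real m) * D powr (- \<beta> / 2)))"
    by (intro sum_mono mult_left_mono prob_S) auto
  also have "\<dots> = D powr (- \<beta> / 2) * (\<Sum>m\<le>n. 2 powr ((\<tau> - \<beta>) * real m))"
  proof -
    have *: "2 powr (\<tau> * real m) * (2 powr (- \<beta> * real m) * d) = d * 2 powr ((\<tau> - \<beta>) * real m)"
      for m and d :: real
    proof -
      have "(\<tau> - \<beta>) * real m = \<tau> * real m + - \<beta> * real m" by (simp add: algebra_simps)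
      then show ?thesis by (simp only: powr_add mult_ac)
    qed
    show ?thesis unfolding * sum_distrib_left ..
  qed
  also have "\<dots> \<le> D powr (- \<beta> / 2) * (1 / (1 - 2 powr (\<tau> - \<beta>)))"
    using \<beta> by (intro mult_left_mono sum_powr_geometric_le) auto
  finally show "expectation (\<lambda>\<omega>. energy_kernel \<tau> n \<bar>b x \<omega> - b y \<omega>\<bar>) \<le>
      max \<bar>x - y\<bar> (2 powr - real (2 * n)) powr (- \<beta> / 2) / (1 - 2 powr (\<tau> - \<beta>))"
    by (simp add: D_def)
qed

text \<open>The expected kernel of exponent \<tau> and depth \<open>n\<close> is dominated by the
  kernel of exponent \<beta> / 2 and depth \<open>2 * n\<close> in time. The potential bound then
  gives one factor \<open>c\<close>, the total mass the other.\<close>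

lemma expectation_discrete_energy_le:
  fixes J :: "'j set"
  assumes J: "finite J" "\<And>j. j \<in> J \<Longrightarrow> w j \<ge> 0" "\<And>j. j \<in> J \<Longrightarrow> x j \<in> {0..1}"
    and \<beta>: "0 < \<beta>" "\<beta> \<le> 1" "\<tau> < \<beta>" "\<beta> / 2 < s"
    and ball: "\<And>l u. l \<le> 2 * n \<Longrightarrow>
      (\<Sum>j\<in>{j\<in>J. \<bar>u - x j\<bar> \<le> 2 powr - real l}. w j) \<le> c * 2 powr (- s * real l)"
  shows "expectation (\<lambda>\<omega>. \<Sum>i\<in>J. \<Sum>j\<in>J. w i * w j * energy_kernel \<tau> n \<bar>b (x i) \<omega> - b (x j) \<omega>\<bar>) \<le>
    c * (2 powr (\<beta> / 2) / (1 - 2 powr (\<tau> - \<beta>)) * (c / (1 - 2 powr (\<beta> / 2 - s))))"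
proof -
  define C where "C = 2 powr (\<beta> / 2) / (1 - 2 powr (\<tau> - \<beta>))"
  define P where "P = c / (1 - 2 powr (\<beta> / 2 - s))"
  have pos: "0 < 1 - 2 powr (\<tau> - \<beta>)" "0 < 1 - 2 powr (\<beta> / 2 - s)"
    using \<beta> by (auto simp: powr_less_one)
  then have C: "C > 0" by (simp add: C_def)
  note K_int = integrable_energy_kernel[OF J(3) J(3) _ \<beta>(2,3)]
  have kernel_le: "expectation (\<lambda>\<omega>. energy_kernel \<tau> n \<bar>b (x i) \<omega> - b (x j) \<omega>\<bar>) \<le>
      C * energy_kernel (\<beta> / 2) (2 * n) \<bar>x i - x j\<bar>" if ij: "i \<in> J" "j \<in> J" for i j
  proof -
    define D where "D = max \<bar>x i - x j\<bar> (2 powr - real (2 * n))"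
    have D: "D > 0" "D \<le> 1" "2 powr - real (2 * n) \<le> D" "\<bar>x i - x j\<bar> \<le> D"
    proof -
      have "(2::real) powr - real (2 * n) \<le> 2 powr 0" by (intro powr_mono) auto
      then show "D \<le> 1" using J(3)[OF ij(1)] J(3)[OF ij(2)] by (auto simp: D_def)
    qed (auto simp: D_def less_max_iff_disj)
    have "1 \<le> (2 * D) powr (\<beta> / 2) * energy_kernel (\<beta> / 2) (2 * n) \<bar>x i - x j\<bar>"
      using \<beta> D by (intro energy_kernel_ge) auto
    then have "D powr (- \<beta> / 2) * 1 \<le> D powr (- \<beta> / 2) *
        ((2 * D) powr (\<beta> / 2) * energy_kernel (\<beta> / 2) (2 * n) \<bar>x i - x j\<bar>)"
      by (intro mult_left_mono) auto
    also have "\<dots> = 2 powr (\<beta> / 2) * energy_kernel (\<beta> / 2) (2 * n) \<bar>x i - x j\<bar>"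
      using D by (simp add: powr_mult powr_minus)
    finally have "D powr (- \<beta> / 2) / (1 - 2 powr (\<tau> - \<beta>)) \<le>
        2 powr (\<beta> / 2) * energy_kernel (\<beta> / 2) (2 * n) \<bar>x i - x j\<bar> / (1 - 2 powr (\<tau> - \<beta>))"
      using pos by (intro divide_right_mono) auto
    with expectation_energy_kernel_le[OF J(3)[OF ij(1)] J(3)[OF ij(2)] _ \<beta>(2,3), of n] \<beta>(1)
    show ?thesis by (simp add: C_def D_def)
  qed
  have "expectation (\<lambda>\<omega>. \<Sum>i\<in>J. \<Sum>j\<in>J. w i * w j * energy_kernel \<tau> n \<bar>b (x i) \<omega> - b (x j) \<omega>\<bar>) =
      (\<Sum>i\<in>J. \<Sum>j\<in>J. w i * w j * expectation (\<lambda>\<omega>. energy_kernel \<tau> n \<bar>b (x i) \<omega> - b (x j) \<omega>\<bar>))"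
    using \<beta>(1) K_int by (simp add: Bochner_Integration.integral_sum Bochner_Integration.integrable_sum)
  also have "\<dots> \<le> (\<Sum>i\<in>J. \<Sum>j\<in>J. w i * w j * (C * energy_kernel (\<beta> / 2) (2 * n) \<bar>x i - x j\<bar>))"
    using J by (intro sum_mono mult_left_mono kernel_le) auto
  also have "\<dots> = (\<Sum>i\<in>J. w i * (C * (\<Sum>j\<in>J. w j * energy_kernel (\<beta> / 2) (2 * n) \<bar>x i - x j\<bar>)))"
    by (simp add: sum_distrib_left mult_ac)
  also have "\<dots> \<le> (\<Sum>i\<in>J. w i * (C * P))"
    unfolding P_def using J C \<beta> ball
    by (intro sum_mono mult_left_mono frostman_potential_le) (auto simp: less_imp_le)
  also have "\<dots> = (\<Sum>j\<in>J. w j) * (C * P)" by (simp add: sum_distrib_right)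
  also have "\<dots> \<le> c * (C * P)"
  proof (intro mult_right_mono)
    \<comment> \<open>All points lie in the unit interval, so the ball condition at
      \<open>u = 0\<close>, \<open>l = 0\<close> bounds the whole mass.\<close>
    have "{j\<in>J. \<bar>0 - x j\<bar> \<le> 2 powr - real 0} = J" using J(3) by auto
    then show sum_le: "(\<Sum>j\<in>J. w j) \<le> c" using ball[of 0 0] by simp
    have "0 \<le> (\<Sum>j\<in>J. w j)" using J(2) by (rule sum_nonneg)
    then show "0 \<le> C * P" using C pos sum_le by (simp add: P_def)
  qed
  finally show ?thesis by (simp add: C_def P_def)
qed

lemma AE_hausdorff_measure_image_pos:
  assumes A: "compact A" "A \<subseteq> {0..1}" and s: "hausdorff_measure s A \<noteq> 0"
    and \<tau>: "0 < \<tau>" "\<tau> < 1" "\<tau> < 2 * s"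
  shows "AE \<omega> in M. hausdorff_measure \<tau> ((\<lambda>t. b t \<omega>) ` A) \<noteq> 0"
proof -
  \<comment> \<open>The midpoint of \<tau> and \<open>2 * s\<close>, cut off at \<open>1\<close> as
    the interpolation requires; \<open>\<tau> < 1\<close> keeps it above \<tau>.\<close>
  define \<beta> where "\<beta> = min 1 ((\<tau> + 2 * s) / 2)"
  have \<beta>: "0 < \<beta>" "\<beta> \<le> 1" "\<tau> < \<beta>" "\<beta> / 2 < s" using \<tau> by (auto simp: \<beta>_def min_def field_simps)
  have s0: "s > 0" using \<tau> by simp
  obtain c where c: "c > 0" "\<And>N. \<exists>(J::nat set) w x. finite J \<and> (\<forall>j\<in>J. w j \<ge> 0 \<and> x j \<in> A) \<and>
    c \<le> (\<Sum>j\<in>J. w j) \<and>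
    (\<forall>l\<le>N. \<forall>u. (\<Sum>j\<in>{j\<in>J. \<bar>u - x j\<bar> \<le> 2 powr - real l}. w j) \<le> 3 * 2 powr (- s * real l))"
    by (rule discrete_frostman[OF A(2) s0 s]) blast
  have "\<forall>n. \<exists>(J::nat set) w x. finite J \<and> (\<forall>j\<in>J. w j \<ge> 0 \<and> x j \<in> A) \<and>
    c \<le> (\<Sum>j\<in>J. w j) \<and>
    (\<forall>l\<le>2*n. \<forall>u. (\<Sum>j\<in>{j\<in>J. \<bar>u - x j\<bar> \<le> 2 powr - real l}. w j) \<le> 3 * 2 powr (- s * real l))"
    using c(2) by blast
  \<comment> \<open>Points and weights are fixed for each \<open>n\<close> independently of the
    path, so the energies \<open>X n\<close> are genuine random variables. The Frostman depth
    \<open>2 * n\<close> matches the spatial depth \<open>n\<close>.\<close>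
  then obtain J :: "nat \<Rightarrow> nat set" and w x where
    J': "\<forall>n. finite (J n) \<and> (\<forall>j\<in>J n. w n j \<ge> 0 \<and> x n j \<in> A) \<and> c \<le> (\<Sum>j\<in>J n. w n j) \<and>
    (\<forall>l\<le>2*n. \<forall>u. (\<Sum>j\<in>{j\<in>J n. \<bar>u - x n j\<bar> \<le> 2 powr - real l}. w n j) \<le> 3 * 2 powr (- s * real l))"
    unfolding choice_iff by blast
  then have J: "finite (J n)" "j \<in> J n \<Longrightarrow> w n j \<ge> 0" "j \<in> J n \<Longrightarrow> x n j \<in> A"
    "c \<le> (\<Sum>j\<in>J n. w n j)"
    "l \<le> 2 * n \<Longrightarrow> (\<Sum>j\<in>{j\<in>J n. \<bar>u - x n j\<bar> \<le> 2 powr - real l}. w n j) \<le> 3 * 2 powr (- s * real l)"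
    for n j l u by simp_all
  have J01: "j \<in> J n \<Longrightarrow> x n j \<in> {0..1}" for n j using J(3) A(2) by blast
  define X where
    "X n \<omega> = (\<Sum>i\<in>J n. \<Sum>j\<in>J n. w n i * w n j * energy_kernel \<tau> n \<bar>b (x n i) \<omega> - b (x n j) \<omega>\<bar>)"
    for n \<omega>
  define C where "C = 3 * (2 powr (\<beta> / 2) / (1 - 2 powr (\<tau> - \<beta>)) * (3 / (1 - 2 powr (\<beta> / 2 - s))))"
  have "AE \<omega> in M. \<exists>L\<ge>0. \<exists>\<^sub>F n in sequentially. X n \<omega> \<le> L"
  proof (rule AE_frequently_bounded)
    show "integrable M (X n)" for n
      unfolding X_def using \<beta> J01
      by (intro Bochner_Integration.integrable_sum integrable_mult_right integrable_energy_kernel[where \<beta> = \<beta>])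
        auto
    show "0 \<le> X n \<omega>" for n \<omega>
      unfolding X_def by (intro sum_nonneg mult_nonneg_nonneg energy_kernel_nonneg J)
    show "expectation (X n) \<le> C" for n
      unfolding X_def C_def by (intro expectation_discrete_energy_le J J01 \<beta>)
  qed
  then show ?thesis using continuous_paths
  proof eventually_elim
    case (elim \<omega>)
    then obtain L where L: "L \<ge> 0" "\<exists>\<^sub>F n in sequentially. X n \<omega> \<le> L" by blast
    show ?case
    proof (rule hausdorff_measure_pos_if_bounded_energy[OF _ \<tau>(1) c(1) L(1), where 'j = nat])
      show "compact ((\<lambda>t. b t \<omega>) ` A)"
        using elim(2) A by (intro compact_continuous_image) (auto intro: continuous_on_subset)
      show "\<exists>\<^sub>F n in sequentially. \<exists>(J::nat set) w y. finite J \<and>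
          (\<forall>j\<in>J. w j \<ge> 0 \<and> y j \<in> (\<lambda>t. b t \<omega>) ` A) \<and> c \<le> (\<Sum>j\<in>J. w j) \<and>
          (\<Sum>i\<in>J. \<Sum>j\<in>J. w i * w j * energy_kernel \<tau> n (dist (y i) (y j))) \<le> L"
        using L(2)
      proof (rule frequently_elim1)
        fix n assume "X n \<omega> \<le> L"
        then show "\<exists>(J::nat set) w y. finite J \<and>
          (\<forall>j\<in>J. w j \<ge> 0 \<and> y j \<in> (\<lambda>t. b t \<omega>) ` A) \<and> c \<le> (\<Sum>j\<in>J. w j) \<and>
          (\<Sum>i\<in>J. \<Sum>j\<in>J. w i * w j * energy_kernel \<tau> n (dist (y i) (y j))) \<le> L"
          using J(1)[of n] J(2)[of _ n] J(3)[of _ n] J(4)[of n]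
          by (rule_tac exI[of _ "J n"], rule_tac exI[of _ "w n"],
              rule_tac exI[of _ "\<lambda>j. b (x n j) \<omega>"]) (simp add: X_def dist_real_def)
      qed
    qed
  qed
qed

text \<open>The exponents \<open>\<tau> k\<close> tend to \<open>2 * a\<close> from below, and
  \<open>a < 1/2\<close> keeps them below \<open>1\<close>. Countably many exponents share one
  exceptional null set.\<close>

lemma AE_le_hausdorff_dim_image:
  assumes A: "compact A" "A \<subseteq> {0..1}" "hausdorff_dim A < 1 / 2"
  shows "AE \<omega> in M. 2 * hausdorff_dim A \<le> hausdorff_dim ((\<lambda>t. b t \<omega>) ` A)"
proof -
  obtain a where a: "a \<ge> 0" "hausdorff_dim A = ennreal a"
    using A(3) by (cases "hausdorff_dim A") auto
  have "(1 / 2 :: ennreal) = ennreal 1 / ennreal 2" by simp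
  also have "\<dots> = ennreal (1 / 2)" by (rule divide_ennreal) auto
  finally have "ennreal a < ennreal (1 / 2)" using A(3) a(2) by metis
  then have a_half: "a < 1 / 2" unfolding ennreal_less_iff[OF a(1)] .
  show ?thesis
  proof (cases "a = 0")
    case True
    then show ?thesis using a by simp
  next
    case False
    define \<tau> where "\<tau> k = 2 * a * (1 - 1 / real (k + 2))" for k :: nat
    have \<tau>: "0 < \<tau> k" "\<tau> k < 2 * a" for k
    proof -
      have "0 < 1 - 1 / real (k + 2)" "1 - 1 / real (k + 2) < 1" by auto
      moreover have "0 < 2 * a" using a False by simp
      ultimately show "0 < \<tau> k" "\<tau> k < 2 * a"
        unfolding \<tau>_def by (auto simp: zero_less_mult_iff mult_less_cancel_left2)
    qed
    have "AE \<omega> in M. hausdorff_measure (\<tau> k) ((\<lambda>t. b t \<omega>) ` A) \<noteq> 0" for k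
    proof (rule AE_hausdorff_measure_image_pos[OF A(1,2)])
      \<comment> \<open>Halfway between \<open>\<tau> k / 2\<close> and the dimension
        \<open>a\<close>: below \<open>a\<close>, so \<open>A\<close> has nonzero
        \<open>s\<close>-measure, yet large enough for \<open>\<tau> k < 2 * s\<close>.\<close>
      define s where "s = (\<tau> k / 2 + a) / 2"
      have s: "\<tau> k < 2 * s" "s < a" "s > 0" using \<tau>[of k] by (auto simp: s_def)
      show "hausdorff_measure s A \<noteq> 0"
      proof
        assume "hausdorff_measure s A = 0"
        with s have "hausdorff_dim A \<le> ennreal s" by (intro hausdorff_dim_le) auto
        with s a show False by simp
      qed
      show "0 < \<tau> k" "\<tau> k < 1" "\<tau> k < 2 * s" using \<tau>[of k] a_half s by auto
    qed
    then have "AE \<omega> in M. \<forall>k. hausdorff_measure (\<tau> k) ((\<lambda>t. b t \<omega>) ` A) \<noteq> 0"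
      by (simp add: AE_all_countable)
    then show ?thesis
    proof eventually_elim
      case (elim \<omega>)
      have "\<tau> \<longlonglongrightarrow> 2 * a" unfolding \<tau>_def by real_asymp
      then have "(\<lambda>k. ennreal (\<tau> k)) \<longlonglongrightarrow> ennreal (2 * a)" by (rule tendsto_ennrealI)
      then have "ennreal (2 * a) \<le> hausdorff_dim ((\<lambda>t. b t \<omega>) ` A)"
        using elim \<tau> by (intro LIMSEQ_le_const2) (auto intro!: le_hausdorff_dim simp: less_imp_le)
      then show ?case using a by (simp add: ennreal_mult)
    qed
  qed
qed

end

theorem theorem4p4:
  fixes A :: "real set" and \<alpha> :: ennreal
    and M :: "'w measure" and b :: "real \<Rightarrow> 'w \<Rightarrow> real"
  assumes "compact A" and "A \<subseteq> {0..1}"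
    and "hausdorff_dim A = \<alpha>" and "\<alpha> < 1 / 2"
    and "brownian_motion M b"
  shows "AE \<omega> in M. hausdorff_dim ((\<lambda>t. b t \<omega>) ` A) = 2 * \<alpha>"
proof -
  interpret brownian_motion M b by fact
  have "AE \<omega> in M. hausdorff_dim ((\<lambda>t. b t \<omega>) ` A) \<le> 2 * \<alpha>"
    using AE_hausdorff_dim_image_le[OF assms(2)] assms(3) by simp
  moreover have "AE \<omega> in M. 2 * \<alpha> \<le> hausdorff_dim ((\<lambda>t. b t \<omega>) ` A)"
    using AE_le_hausdorff_dim_image[OF assms(1,2)] assms(3,4) by simp
  ultimately show ?thesis by eventually_elim simp
qed

end
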